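(* Let $\mathbb{X}\subseteq\mathbb{P}^2$ be a $\Bbbk$-configuration of type $d=(d_1,\dots,d_s)\neq(1)$. Then there exists an integer $m_0$ such that for all integers $m\geq m_0$, $$\Delta \mathbf{H}_{m\mathbb{X}}(m d_s-1)=\text{the number of lines in }\mathbb{P}^2\text{ containing exactly } d_s \text{ points of }\mathbb{X}.$$ Moreover, if $d_s>s$ one may take $m_0=2$, and if $d_s=s$ one may take $m_0=s+1$.
   Context: $\Bbbk$ is an algebraically closed field and $R=\Bbbk[x_0,x_1,x_2]$. A $\Bbbk$-configuration of type $(d_1,\dots,d_s)$ is a finite set $\mathbb{X}\subseteq\mathbb{P}^2$ for which there exist integers $1\le d_1<\cdots<d_s$, subsets $\mathbb{X}_1,\dots,\mathbb{X}_s$ of $\mathbb{X}$ and distinct lines $\mathbb{L}_1,\dots,\mathbb{L}_s\subseteq\mathbb{P}^2$ such that (1) $\mathbb{X}=\bigcup_{i=1}^s\mathbb{X}_i$; (2) $|\mathbb{X}_i|=d_i$ and $\mathbb{X}_i\subseteq\mathbb{L}_i$ for each $i$; (3) for $1<i\le s$, $\mathbb{L}_i$ contains no point of $\mathbb{X}_j$ for any $j<i$. (Note $d_s\ge s$ always.) For a point $P$, $I_P\subseteq R$ is its homogeneous prime ideal; for $\mathbb{X}=\{P_1,\dots,P_n\}$ and a positive integer $m$, $m\mathbb{X}$ is the fat point scheme defined by $I_{m\mathbb{X}}=I_{P_1}^m\cap\cdots\cap I_{P_n}^m$. For a scheme $\mathbb{Z}$ with ideal $I_\mathbb{Z}$,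 $\mathbf{H}_\mathbb{Z}(t)=\dim_\Bbbk R_t-\dim_\Bbbk (I_\mathbb{Z})_t$ is its Hilbert function, and $\Delta\mathbf{H}_\mathbb{Z}(t)=\mathbf{H}_\mathbb{Z}(t)-\mathbf{H}_\mathbb{Z}(t-1)$ with $\mathbf{H}_\mathbb{Z}(t)=0$ for $t<0$. *)

theory Defs
  imports Main "HOL-Computational_Algebra.Polynomial" "HOL-Library.Function_Algebras"
begin

text \<open>Points of P^2 are represented by nonzero coordinate vectors in k^3 (up to scaling);
  polynomials of R = k[x0,x1,x2] of degree t are represented by coefficient functions on
  exponent triples (a,b,c) with a+b+c = t.\<close>

type_synonym 'a vec3 = "'a \<times> 'a \<times> 'a"

definition proportional :: "'a::field vec3 \<Rightarrow> 'a vec3 \<Rightarrow> bool" where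
  "proportional u v \<longleftrightarrow> (\<exists>c. c \<noteq> 0 \<and> (case u of (u0,u1,u2) \<Rightarrow> case v of (v0,v1,v2) \<Rightarrow>
       v0 = c * u0 \<and> v1 = c * u1 \<and> v2 = c * u2))"

definition proj_point_set :: "'a::field vec3 set \<Rightarrow> bool" where
  "proj_point_set X \<longleftrightarrow> finite X \<and> (0,0,0) \<notin> X \<and>
     (\<forall>u\<in>X. \<forall>v\<in>X. proportional u v \<longrightarrow> u = v)"

definition line_of :: "'a::field vec3 \<Rightarrow> 'a vec3 set" where
  "line_of l = {(x0,x1,x2). case l of (a,b,c) \<Rightarrow> a*x0 + b*x1 + c*x2 = 0}"

definition proj_lines :: "'a::field vec3 set set" where
  "proj_lines = {line_of l | l. l \<noteq> (0,0,0)}"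

definition k_configuration :: "'a::field vec3 set \<Rightarrow> nat list \<Rightarrow> bool" where
  "k_configuration X d \<longleftrightarrow> proj_point_set X \<and> d \<noteq> [] \<and>
     1 \<le> d ! 0 \<and> sorted_wrt (<) d \<and>
     (\<exists>Xs :: nat \<Rightarrow> 'a vec3 set. \<exists>L :: nat \<Rightarrow> 'a vec3 set.
        X = (\<Union>i<length d. Xs i) \<and>
        (\<forall>i<length d. L i \<in> proj_lines) \<and>
        (\<forall>i<length d. \<forall>j<length d. i \<noteq> j \<longrightarrow> L i \<noteq> L j) \<and>
        (\<forall>i<length d. card (Xs i) = d ! i \<and> Xs i \<subseteq> L i) \<and>
        (\<forall>i<length d. \<forall>j<i. Xs j \<inter> L i = {}))"

definition mon_exps :: "nat \<Rightarrow> (nat \<times> nat \<times> nat) set" where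
  "mon_exps t = {(a,b,c). a + b + c = t}"

definition forms :: "nat \<Rightarrow> (nat \<times> nat \<times> nat \<Rightarrow> 'a::field) set" where
  "forms t = {f. \<forall>e. e \<notin> mon_exps t \<longrightarrow> f e = 0}"

text \<open>Coefficient of y^g in f(p + y) (Hasse derivative of f at p).\<close>
definition hasse :: "nat \<Rightarrow> (nat \<times> nat \<times> nat \<Rightarrow> 'a::field) \<Rightarrow> 'a vec3 \<Rightarrow> nat \<times> nat \<times> nat \<Rightarrow> 'a" where
  "hasse t f p g = (\<Sum>e\<in>mon_exps t. case e of (a,b,c) \<Rightarrow> case g of (g0,g1,g2) \<Rightarrow>
      case p of (p0,p1,p2) \<Rightarrow>
        f e * of_nat ((a choose g0) * (b choose g1) * (c choose g2))
          * p0 ^ (a - g0) * p1 ^ (b - g1) * p2 ^ (c - g2))"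

text \<open>(I_P^m)_t for the point P with representative p: all terms of f(p+y) have y-degree >= m.\<close>
definition in_fat_ideal :: "nat \<Rightarrow> nat \<Rightarrow> 'a::field vec3 \<Rightarrow> (nat \<times> nat \<times> nat \<Rightarrow> 'a) \<Rightarrow> bool" where
  "in_fat_ideal t m p f \<longleftrightarrow>
     (\<forall>g0 g1 g2. g0 + g1 + g2 < m \<longrightarrow> hasse t f p (g0,g1,g2) = 0)"

definition fat_ideal_deg :: "nat \<Rightarrow> 'a::field vec3 set \<Rightarrow> nat \<Rightarrow> (nat \<times> nat \<times> nat \<Rightarrow> 'a) set" where
  "fat_ideal_deg m X t = {f \<in> forms t. \<forall>p\<in>X. in_fat_ideal t m p f}"

definition kdim :: "(nat \<times> nat \<times> nat \<Rightarrow> 'a::field) set \<Rightarrow> nat" where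
  "kdim V = vector_space.dim (\<lambda>c f. (\<lambda>x. c * f x)) V"

definition hilb_fat :: "nat \<Rightarrow> 'a::field vec3 set \<Rightarrow> int \<Rightarrow> int" where
  "hilb_fat m X t = (if t < 0 then 0 else
     int (kdim (forms (nat t) :: (nat \<times> nat \<times> nat \<Rightarrow> 'a) set))
     - int (kdim (fat_ideal_deg m X (nat t))))"

definition delta_hilb_fat :: "nat \<Rightarrow> 'a::field vec3 set \<Rightarrow> int \<Rightarrow> int" where
  "delta_hilb_fat m X t = hilb_fat m X t - hilb_fat m X (t - 1)"

end

theory Submission
  imports Defs
begin

text \<open>
  Removing a line \<open>L\<close> from a fat point scheme \<open>Z\<close> lowers the multiplicities on \<open>L\<close> by one and the
  degree by one; restriction to \<open>L\<close> compares \<open>h\<^sup>1(I\<^sub>Z(t))\<close> with \<open>h\<^sup>1\<close> of the residual scheme in degree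
  \<open>t - 1\<close>, up to the excess \<open>deg (Z \<inter> L) - (t + 1)\<close>. With \<open>n = d\<^sub>s\<close>, the claim amounts to
  \<open>h\<^sup>1 = 0\<close> in degree \<open>mn - 1\<close> and \<open>h\<^sup>1 = l\<close> in degree \<open>mn - 2\<close>, where \<open>l\<close> is the number of lines through
  \<open>n\<close> points. Removing these \<open>l\<close> lines one after the other gives \<open>h\<^sup>1 \<ge> l\<close>, because two of them share at
  most one point. The upper bounds come from removing \<open>L\<^sub>s, \<dots>, L\<^sub>1\<close> in \<open>m\<close> rounds. If \<open>d\<^sub>s > s\<close>, excess
  (of one) occurs only in the first round, at lines through \<open>n\<close> points. If \<open>d\<^sub>s = s\<close>, then
  \<open>X\<^sub>1\<close> is a single point \<open>P\<close>, and \<open>L\<^sub>1\<close> is replaced in round \<open>r\<close> by the line joining \<open>P\<close> to the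
  \<open>r\<close>-th point of \<open>X\<^sub>s\<close>. After \<open>s\<close> rounds every point of \<open>X\<^sub>s\<close> has been hit once more than the other rounds
  require, so the last round can do without \<open>L\<^sub>s\<close>; this is where \<open>m \<ge> s + 1\<close> enters.
\<close>

section \<open>Dimensions of function spaces\<close>

text \<open>The Hilbert function of the fat points is their degree minus h^1, so its first
  difference in degree m n - 1 is h^1(m n - 2) - h^1(m n - 1). Why the rounds work, with indices
  from 0: when line i is removed in round r, the points of \<open>Xs i\<close> have multiplicity at
  most m - r, and those of a later \<open>Xs j\<close>, already hit in this round, at most m - r -
  1. Each later \<open>Xs j\<close> has at most one point on the line, and strict growth of d gives
  d_i + (s - 1 - i) <= n, so the degree on the line is just small enough. A finished round costs s
  degrees where n are available; for s < n this slack confines excess to the first round. For s = n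
  there are two obstacles: the same line could show excess in every round, and m rounds of s lines
  would use m n degrees while only m n - 1 are at hand. A point of \<open>Xs (s - 1)\<close> hit
  earlier by a line other than its own settles the first, because it lowers the degree on every
  later line through it; the lines through P are varied so that each such point gets such a hit,
  which settles the second. Forms are treated as functions because the field is infinite; a change
  of coordinates is then a composition.\<close>

lemma infinite_UNIV_alg_closed: "infinite (UNIV :: 'a::alg_closed_field set)"
proof
  assume fin: "finite (UNIV :: 'a set)"
  define p :: "'a poly" where "p = (\<Prod>a\<in>UNIV. [:-a, 1:]) + 1"
  have "degree (\<Prod>a\<in>(UNIV::'a set). [:-a, 1:]) = card (UNIV :: 'a set)"
    by (subst degree_prod_eq_sum_degree) auto
  moreover have "card (UNIV :: 'a set) > 0"
    using fin by (simp add: card_gt_0_iff)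
  ultimately have "degree p > 0"
    unfolding p_def by (subst degree_add_eq_left) auto
  then obtain z where "poly p z = 0"
    using alg_closed_imp_poly_has_root by blast
  moreover have "poly (\<Prod>a\<in>UNIV. [:-a, 1:]) z = 0"
    using fin by (auto simp: poly_prod prod_zero_iff intro!: exI[of _ z])
  ultimately show False
    by (simp add: p_def)
qed

lemma poly_eqI_fun:
  fixes p q :: "'a::alg_closed_field poly"
  assumes "\<And>x. poly p x = poly q x"
  shows "p = q"
proof (rule ccontr)
  assume "p \<noteq> q"
  then have "finite {x. poly (p - q) x = 0}"
    by (intro poly_roots_finite) auto
  moreover have "{x. poly (p - q) x = 0} = UNIV"
    using assms by auto
  ultimately show False
    using infinite_UNIV_alg_closed by metis
qed

lemma univariate_coeffs_zero:
  fixes c :: "nat \<Rightarrow> 'a::alg_closed_field"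
  assumes "\<And>x. (\<Sum>i\<le>n. c i * x ^ i) = 0" and "i \<le> n"
  shows "c i = 0"
proof -
  have "(\<Sum>i\<le>n. monom (c i) i) = 0"
    by (rule poly_eqI_fun) (simp add: poly_sum poly_monom assms(1))
  then have "coeff (\<Sum>i\<le>n. monom (c i) i) i = 0"
    by simp
  then show ?thesis
    using assms(2) by (simp add: coeff_sum)
qed

text \<open>Kept as an explicit lambda term so that \<open>fs.dim\<close> is literally the dimension
  used in \<open>kdim\<close>.\<close>

abbreviation (input) fscale :: "'a::field \<Rightarrow> ('b \<Rightarrow> 'a) \<Rightarrow> 'b \<Rightarrow> 'a"
  where "fscale c f \<equiv> (\<lambda>x. c * f x)"

interpretation fs: vector_space fscale
  by unfold_locales (auto simp: fun_eq_iff algebra_simps)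

lemma sum_fun_apply: "(\<Sum>i\<in>I. f i) x = (\<Sum>i\<in>I. f i x)"
  by (induction I rule: infinite_finite_induct) auto

lemma fs_subspaceI:
  assumes "(\<lambda>x. 0) \<in> V" "\<And>f g. f \<in> V \<Longrightarrow> g \<in> V \<Longrightarrow> (\<lambda>x. f x + g x) \<in> V"
    "\<And>c f. f \<in> V \<Longrightarrow> (\<lambda>x. c * f x) \<in> V"
  shows "fs.subspace V"
  unfolding fs.subspace_def using assms by (auto simp: zero_fun_def plus_fun_def)

text \<open>The finite spanning set \<open>B\<close> excludes infinite dimension, where
  \<open>dim\<close> is the default value 0 and monotonicity fails.\<close>

lemma fs_dim_mono:
  assumes "V \<subseteq> fs.span W" "W \<subseteq> fs.span B" "finite B"
  shows "fs.dim V \<le> fs.dim W"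
proof -
  obtain C where C: "C \<subseteq> W" "fs.independent C" "W \<subseteq> fs.span C" "card C = fs.dim W"
    by (rule fs.basis_exists)
  have "finite C"
    using C(1,2) assms(2,3) fs.independent_span_bound by blast
  moreover have "V \<subseteq> fs.span C"
    using assms(1) C(3) fs.span_minimal[OF C(3) fs.subspace_span] by blast
  ultimately show ?thesis
    using fs.dim_le_card C(4) by metis
qed

text \<open>One linear condition costs at most one dimension. Linearity is required only on
  \<open>V\<close> because the functionals used later come from \<open>THE\<close> or
  \<open>inv_into\<close> and are linear only on forms of a fixed degree.\<close>

lemma fs_dim_kernel:
  fixes \<phi> :: "('b \<Rightarrow> 'a::field) \<Rightarrow> 'a"
  assumes V: "fs.subspace V" and fin: "V \<subseteq> fs.span B" "finite B"
    and add: "\<And>f g. f \<in> V \<Longrightarrow> g \<in> V \<Longrightarrow> \<phi> (f + g) = \<phi> f + \<phi> g"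
    and scale: "\<And>c f. f \<in> V \<Longrightarrow> \<phi> (fscale c f) = c * \<phi> f"
  shows "fs.dim V \<le> fs.dim {f \<in> V. \<phi> f = 0} + 1"
proof (cases "\<exists>f0\<in>V. \<phi> f0 \<noteq> 0")
  case False
  then have "{f \<in> V. \<phi> f = 0} = V"
    by auto
  then show ?thesis
    by simp
next
  case True
  then obtain f0 where f0: "f0 \<in> V" "\<phi> f0 \<noteq> 0"
    by auto
  let ?K = "{f \<in> V. \<phi> f = 0}"
  obtain C where C: "C \<subseteq> ?K" "fs.independent C" "?K \<subseteq> fs.span C" "card C = fs.dim ?K"
    by (rule fs.basis_exists)
  have "C \<subseteq> fs.span B"
    using C(1) fin(1) by auto
  then have "finite C"
    using C(2) fin(2) fs.independent_span_bound by blast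
  have "V \<subseteq> fs.span (insert f0 C)"
  proof
    fix f assume f: "f \<in> V"
    define c where "c = \<phi> f / \<phi> f0"
    have m: "fscale (- c) f0 \<in> V"
      using V f0(1) by (rule fs.subspace_scale)
    have "f + fscale (- c) f0 \<in> ?K"
      using f m add[OF f m] scale[OF f0(1), of "- c"] f0(2) fs.subspace_add[OF V f m]
      by (simp add: c_def)
    then have "f + fscale (- c) f0 \<in> fs.span (insert f0 C)"
      using C(3) fs.span_mono[of C "insert f0 C"] by blast
    moreover have "fscale c f0 \<in> fs.span (insert f0 C)"
      by (intro fs.span_scale fs.span_base) auto
    ultimately have s: "(f + fscale (- c) f0) + fscale c f0 \<in> fs.span (insert f0 C)"
      by (rule fs.span_add)
    have "(f + fscale (- c) f0) + fscale c f0 = f"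
      by (auto simp: fun_eq_iff)
    then show "f \<in> fs.span (insert f0 C)"
      using s by metis
  qed
  then have "fs.dim V \<le> card (insert f0 C)"
    using \<open>finite C\<close> by (intro fs.dim_le_card) auto
  also have "\<dots> \<le> fs.dim ?K + 1"
    using C(4) \<open>finite C\<close> by (simp add: card_insert_if)
  finally show ?thesis .
qed

lemma fs_dim_kernels:
  fixes \<phi> :: "'i \<Rightarrow> ('b \<Rightarrow> 'a::field) \<Rightarrow> 'a"
  assumes "finite I" and V: "fs.subspace V" and fin: "V \<subseteq> fs.span B" "finite B"
    and add: "\<And>i f g. i \<in> I \<Longrightarrow> f \<in> V \<Longrightarrow> g \<in> V \<Longrightarrow> \<phi> i (f + g) = \<phi> i f + \<phi> i g"
    and scale: "\<And>i c f. i \<in> I \<Longrightarrow> f \<in> V \<Longrightarrow> \<phi> i (fscale c f) = c * \<phi> i f"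
  shows "fs.dim V \<le> fs.dim {f \<in> V. \<forall>i\<in>I. \<phi> i f = 0} + card I \<and> fs.subspace {f \<in> V. \<forall>i\<in>I. \<phi> i f = 0}"
  using assms(1) add scale
proof (induction I)
  case empty
  then show ?case
    using V by simp
next
  case (insert i I)
  let ?W = "{f \<in> V. \<forall>i\<in>I. \<phi> i f = 0}"
  have IH: "fs.dim V \<le> fs.dim ?W + card I" "fs.subspace ?W"
    using insert by auto
  have eq: "{f \<in> V. \<forall>i\<in>insert i I. \<phi> i f = 0} = {f \<in> ?W. \<phi> i f = 0}"
    by auto
  have "fs.dim ?W \<le> fs.dim {f \<in> ?W. \<phi> i f = 0} + 1"
  proof (rule fs_dim_kernel[OF IH(2) _ fin(2)])
    show "?W \<subseteq> fs.span B"
      using fin(1) by auto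
    show "\<phi> i (f + g) = \<phi> i f + \<phi> i g" if "f \<in> ?W" "g \<in> ?W" for f g
      using that by (intro insert.prems(1)) auto
    show "\<phi> i (fscale c f) = c * \<phi> i f" if "f \<in> ?W" for c f
      using that by (intro insert.prems(2)) auto
  qed
  moreover have "fs.subspace {f \<in> ?W. \<phi> i f = 0}"
  proof (rule fs.subspaceI)
    have "\<phi> i 0 = 0"
      using insert.prems(2)[of i 0 0] fs.subspace_0[OF V] by (simp add: zero_fun_def)
    then show "0 \<in> {f \<in> ?W. \<phi> i f = 0}"
      using fs.subspace_0[OF IH(2)] by blast
    show "f + g \<in> {f \<in> ?W. \<phi> i f = 0}" if "f \<in> {f \<in> ?W. \<phi> i f = 0}" "g \<in> {f \<in> ?W. \<phi> i f = 0}" for f g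
    proof -
      have "\<phi> i (f + g) = \<phi> i f + \<phi> i g"
        using that by (intro insert.prems(1)) auto
      then show ?thesis
        using that fs.subspace_add[OF IH(2), of f g] by (metis (mono_tags, lifting) add_0 mem_Collect_eq)
    qed
    show "fscale c f \<in> {f \<in> ?W. \<phi> i f = 0}" if "f \<in> {f \<in> ?W. \<phi> i f = 0}" for c f
    proof -
      have "\<phi> i (fscale c f) = c * \<phi> i f"
        using that by (intro insert.prems(2)) auto
      then show ?thesis
        using that fs.subspace_scale[OF IH(2), of f c] by (metis (mono_tags, lifting) mult_zero_right mem_Collect_eq)
    qed
  qed
  ultimately show ?case
    using IH(1) insert.hyps unfolding eq by simp
qed

lemma fs_dim_image_eq:
  fixes T :: "('b \<Rightarrow> 'a::field) \<Rightarrow> 'c \<Rightarrow> 'a"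
  assumes V: "fs.subspace V"
    and add: "\<And>f g. T (f + g) = T f + T g" and scale: "\<And>c f. T (fscale c f) = fscale c (T f)"
    and inj: "inj_on T V"
  shows "fs.dim (T ` V) = fs.dim V"
proof -
  interpret vp: vector_space_pair "fscale :: 'a \<Rightarrow> ('b \<Rightarrow> 'a) \<Rightarrow> _" "fscale :: 'a \<Rightarrow> ('c \<Rightarrow> 'a) \<Rightarrow> _"
    by unfold_locales
  have lin: "Vector_Spaces.linear fscale fscale T"
    unfolding Vector_Spaces.linear_iff
    by (intro conjI allI add scale) unfold_locales
  obtain C where C: "C \<subseteq> V" "fs.independent C" "V \<subseteq> fs.span C" "card C = fs.dim V"
    by (rule fs.basis_exists)
  have "fs.span C \<subseteq> V"
    using C(1) V by (rule fs.span_minimal)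
  then have sp: "fs.span C = V"
    using C(3) by auto
  have "fs.independent (T ` C)"
    using vp.linear_independent_injective_image[OF lin C(2)] inj sp by simp
  moreover have "fs.span (T ` C) = T ` V"
    using vp.linear_span_image[OF lin, of C] sp by simp
  ultimately have "fs.dim (T ` V) = card (T ` C)"
    by (metis fs.dim_span_eq_card_independent)
  also have "\<dots> = card C"
    using inj C(1) by (intro card_image) (auto intro: inj_on_subset)
  finally show ?thesis
    using C(4) by simp
qed

section \<open>Forms as polynomial functions\<close>

fun mon_val :: "nat \<times> nat \<times> nat \<Rightarrow> 'a::field vec3 \<Rightarrow> 'a" where
  "mon_val (a, b, c) (x, y, z) = x ^ a * y ^ b * z ^ c"

definition eval_form :: "nat \<Rightarrow> (nat \<times> nat \<times> nat \<Rightarrow> 'a::field) \<Rightarrow> 'a vec3 \<Rightarrow> 'a" where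
  "eval_form t f v = (\<Sum>e\<in>mon_exps t. f e * mon_val e v)"

text \<open>Over an infinite field a form is determined by its values
  (\<open>eval_form_inj\<close>), so this is a faithful copy of \<open>forms t\<close> on which
  linear substitutions are easy to write down.\<close>

definition PF :: "nat \<Rightarrow> ('a::field vec3 \<Rightarrow> 'a) set" where
  "PF t = range (eval_form t)"

lemma mon_exps_image:
  "mon_exps t = (\<lambda>(b, c). (t - b - c, b, c)) ` (SIGMA b:{..t}. {..t - b})"
  by (force simp: mon_exps_def image_iff)

lemma finite_mon_exps [simp]: "finite (mon_exps t)"
  by (simp add: mon_exps_image)

lemma sum_mon_exps:
  "(\<Sum>e\<in>mon_exps t. G e) = (\<Sum>b\<le>t. \<Sum>c\<le>t - b. G (t - b - c, b, c))"
  unfolding mon_exps_image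
  by (subst sum.reindex) (auto simp: inj_on_def sum.Sigma split: prod.splits intro!: sum.cong)

lemma card_mon_exps: "2 * card (mon_exps t) = (t + 1) * (t + 2)"
proof -
  have "card (mon_exps t) = (\<Sum>b\<le>t. t - b + 1)"
    unfolding mon_exps_image by (subst card_image) (auto simp: inj_on_def)
  also have "\<dots> = (\<Sum>b\<le>t. b + 1)"
    by (rule sum.reindex_bij_witness[of _ "\<lambda>b. t - b" "\<lambda>b. t - b"]) auto
  also have "2 * \<dots> = (t + 1) * (t + 2)"
    by (induction t) auto
  finally show ?thesis .
qed

text \<open>Setting x = 1 loses nothing for a form of fixed degree; what remains is a polynomial in
  y whose coefficients are polynomials in z, and the univariate statement applies twice.\<close>

lemma eval_form_zero_imp:
  fixes f :: "nat \<times> nat \<times> nat \<Rightarrow> 'a::alg_closed_field"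
  assumes "\<And>v. eval_form t f v = 0" "e \<in> mon_exps t"
  shows "f e = 0"
proof -
  have *: "(\<Sum>b\<le>t. (\<Sum>c\<le>t - b. f (t - b - c, b, c) * z ^ c) * y ^ b) = 0" for y z
  proof -
    have "(\<Sum>b\<le>t. (\<Sum>c\<le>t - b. f (t - b - c, b, c) * z ^ c) * y ^ b) = eval_form t f (1, y, z)"
      unfolding eval_form_def sum_mon_exps sum_distrib_right by (intro sum.cong) auto
    then show ?thesis
      using assms(1) by simp
  qed
  obtain b c where e: "b \<le> t" "c \<le> t - b" "e = (t - b - c, b, c)"
    using assms(2) by (auto simp: mon_exps_image)
  have "(\<Sum>c\<le>t - b. f (t - b - c, b, c) * z ^ c) = 0" for z
    using univariate_coeffs_zero[OF * e(1)] by simp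
  from univariate_coeffs_zero[OF this e(2)] show ?thesis
    using e(3) by simp
qed

lemma formsD: "f \<in> forms t \<Longrightarrow> e \<notin> mon_exps t \<Longrightarrow> f e = 0"
  unfolding forms_def by blast

lemma eval_form_add: "eval_form t (f + g) = eval_form t f + eval_form t g"
  by (auto simp: fun_eq_iff eval_form_def algebra_simps sum.distrib)

lemma eval_form_scale: "eval_form t (fscale c f) = fscale c (eval_form t f)"
  by (auto simp: fun_eq_iff eval_form_def sum_distrib_left mult_ac)

lemma eval_form_inj:
  fixes f g :: "nat \<times> nat \<times> nat \<Rightarrow> 'a::alg_closed_field"
  assumes "f \<in> forms t" "g \<in> forms t" "eval_form t f = eval_form t g"
  shows "f = g"
proof
  fix e
  have "eval_form t (f + fscale (-1) g) v = 0" for v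
    unfolding eval_form_add eval_form_scale by (simp add: assms(3))
  then have "e \<in> mon_exps t \<Longrightarrow> f e = g e"
    using eval_form_zero_imp[of t "f + fscale (-1) g" e] by simp
  then show "f e = g e"
    using formsD[OF assms(1)] formsD[OF assms(2)] by metis
qed

lemma eval_form_restrict:
  "eval_form t (\<lambda>e. if e \<in> mon_exps t then f e else 0) = eval_form t f"
  by (auto simp: eval_form_def)

lemma PF_eq: "PF t = eval_form t ` forms t"
proof -
  have "eval_form t f \<in> eval_form t ` forms t" for f :: "nat \<times> nat \<times> nat \<Rightarrow> 'a"
    by (rule image_eqI[where x = "\<lambda>e. if e \<in> mon_exps t then f e else 0"])
      (auto simp: forms_def eval_form_restrict)
  then show ?thesis
    by (auto simp: PF_def)
qed

lemma PFE:
  assumes "F \<in> PF t"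
  obtains f where "f \<in> forms t" "F = eval_form t f"
  using assms by (auto simp: PF_eq)

lemma PF_add: "F \<in> PF t \<Longrightarrow> G \<in> PF t \<Longrightarrow> (\<lambda>v. F v + G v) \<in> PF t"
proof (elim PFE)
  fix f g assume "F = eval_form t f" "G = eval_form t g"
  then have "(\<lambda>v. F v + G v) = eval_form t (f + g)"
    by (simp add: eval_form_add fun_eq_iff)
  then show ?thesis
    by (auto simp: PF_def)
qed

lemma PF_scale: "F \<in> PF t \<Longrightarrow> (\<lambda>v. c * F v) \<in> PF t"
proof (erule PFE)
  fix f assume "F = eval_form t f"
  then have "(\<lambda>v. c * F v) = eval_form t (fscale c f)"
    by (simp only: eval_form_scale)
  then show ?thesis
    by (auto simp: PF_def)
qed

lemma PF_0: "(\<lambda>v. 0) \<in> PF t"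
  unfolding PF_def by (rule range_eqI[of _ _ "\<lambda>_. 0"]) (simp add: eval_form_def fun_eq_iff)

lemma PF_subspace: "fs.subspace (PF t)"
  by (intro fs_subspaceI PF_add PF_scale PF_0)

lemma PF_sum: "(\<And>i. i \<in> I \<Longrightarrow> F i \<in> PF t) \<Longrightarrow> (\<lambda>v. \<Sum>i\<in>I. F i v) \<in> PF t"
  by (induction I rule: infinite_finite_induct) (auto intro: PF_0 PF_add)

lemma PF_mon_val:
  assumes "e \<in> mon_exps t"
  shows "mon_val e \<in> PF t"
  unfolding PF_def
  by (rule range_eqI[of _ _ "\<lambda>e'. if e' = e then 1 else 0"])
    (simp add: eval_form_def fun_eq_iff if_distrib[of "\<lambda>x. x * _"] assms cong: if_cong)

lemma PF_finite_span: "PF t \<subseteq> fs.span (mon_val ` mon_exps t)"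
proof
  fix F :: "'a vec3 \<Rightarrow> 'a" assume "F \<in> PF t"
  then obtain f where f: "F = eval_form t f"
    by (auto simp: PF_def)
  have "F = (\<Sum>e\<in>mon_exps t. fscale (f e) (mon_val e))"
    by (simp add: f fun_eq_iff eval_form_def sum_fun_apply)
  also have "\<dots> \<in> fs.span (mon_val ` mon_exps t)"
    by (intro fs.span_sum fs.span_scale fs.span_base imageI)
  finally show "F \<in> fs.span (mon_val ` mon_exps t)" .
qed

lemma PF_mult:
  assumes "F \<in> PF s" "G \<in> PF t"
  shows "(\<lambda>v. F v * G v) \<in> PF (s + t)"
proof -
  obtain f g where fg: "F = eval_form s f" "G = eval_form t g"
    using assms by (auto simp: PF_def)
  have "(\<lambda>v. f e * (g e' * (mon_val e v * mon_val e' v))) \<in> PF (s + t)"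
    if "e \<in> mon_exps s" "e' \<in> mon_exps t" for e e'
  proof -
    obtain a b c a' b' c' where e: "e = (a, b, c)" "e' = (a', b', c')"
      by (metis prod_cases3)
    have "(\<lambda>v. mon_val e v * mon_val e' v) = mon_val (a + a', b + b', c + c')"
      by (auto simp: e fun_eq_iff power_add)
    moreover have "(a + a', b + b', c + c') \<in> mon_exps (s + t)"
      using that by (auto simp: e mon_exps_def)
    ultimately have "(\<lambda>v. mon_val e v * mon_val e' v) \<in> PF (s + t)"
      using PF_mon_val by metis
    then show ?thesis
      by (intro PF_scale)
  qed
  then have "(\<lambda>v. \<Sum>e\<in>mon_exps s. \<Sum>e'\<in>mon_exps t. f e * (g e' * (mon_val e v * mon_val e' v))) \<in> PF (s + t)"
    by (intro PF_sum)
  then show ?thesis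
    by (simp add: fg eval_form_def sum_product mult_ac)
qed

lemma PF_const: "(\<lambda>v. c) \<in> PF 0"
  unfolding PF_def
  by (rule range_eqI[of _ _ "\<lambda>e. c"]) (auto simp: eval_form_def fun_eq_iff mon_exps_def)

lemma PF_power:
  assumes "F \<in> PF 1"
  shows "(\<lambda>v. F v ^ n) \<in> PF n"
proof (induction n)
  case 0
  then show ?case
    using PF_const[of 1] by simp
next
  case (Suc n)
  then show ?case
    using PF_mult[OF assms, of "\<lambda>v. F v ^ n" n] by simp
qed

section \<open>Linear forms, cross products and changes of frame\<close>

fun dot :: "'a::field vec3 \<Rightarrow> 'a vec3 \<Rightarrow> 'a" where
  "dot (a, b, c) (x, y, z) = a * x + b * y + c * z"

fun cross :: "'a::field vec3 \<Rightarrow> 'a vec3 \<Rightarrow> 'a vec3" where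
  "cross (a, b, c) (x, y, z) = (b * z - c * y, c * x - a * z, a * y - b * x)"

fun along :: "'a::field vec3 \<Rightarrow> 'a vec3 \<Rightarrow> 'a \<Rightarrow> 'a vec3" where
  "along (p0, p1, p2) (v0, v1, v2) s = (p0 + s * v0, p1 + s * v1, p2 + s * v2)"

fun vsc :: "'a::field \<Rightarrow> 'a vec3 \<Rightarrow> 'a vec3" where
  "vsc s (p0, p1, p2) = (s * p0, s * p1, s * p2)"

text \<open>The linear map taking the standard basis to \<open>p\<close>, \<open>q\<close>,
  \<open>r\<close>; a change of coordinates if \<open>det3 p q r\<close> is nonzero.\<close>

fun frame :: "'a::field vec3 \<Rightarrow> 'a vec3 \<Rightarrow> 'a vec3 \<Rightarrow> 'a vec3 \<Rightarrow> 'a vec3" where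
  "frame (p0, p1, p2) (q0, q1, q2) (r0, r1, r2) (x, y, z) =
     (x * p0 + y * q0 + z * r0, x * p1 + y * q1 + z * r1, x * p2 + y * q2 + z * r2)"

abbreviation det3 :: "'a::field vec3 \<Rightarrow> 'a vec3 \<Rightarrow> 'a vec3 \<Rightarrow> 'a" where
  "det3 p q r \<equiv> dot p (cross q r)"

lemma PF_dot: "dot l \<in> PF 1"
proof (cases l)
  case (fields a b c)
  have "(\<lambda>v. a * mon_val (1,0,0) v + b * mon_val (0,1,0) v + c * mon_val (0,0,1) v) \<in> PF 1"
    by (intro PF_add PF_scale PF_mon_val) (auto simp: mon_exps_def)
  also have "(\<lambda>v. a * mon_val (1,0,0) v + b * mon_val (0,1,0) v + c * mon_val (0,0,1) v) = dot l"
    by (auto simp: fun_eq_iff fields)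
  finally show ?thesis .
qed

lemma PF_frame:
  assumes "F \<in> PF t"
  shows "(\<lambda>v. F (frame p q r v)) \<in> PF t"
proof -
  obtain f where f: "F = eval_form t f"
    using assms by (auto simp: PF_def)
  obtain p0 p1 p2 q0 q1 q2 r0 r1 r2 where pqr: "p = (p0, p1, p2)" "q = (q0, q1, q2)" "r = (r0, r1, r2)"
    by (metis prod_cases3)
  have fr: "frame p q r v = (dot (p0, q0, r0) v, dot (p1, q1, r1) v, dot (p2, q2, r2) v)" for v
    by (cases v) (simp add: pqr mult_ac)
  have "(\<lambda>v. mon_val e (frame p q r v)) \<in> PF t" if "e \<in> mon_exps t" for e
  proof -
    obtain a b c where e: "e = (a, b, c)" "a + b + c = t"
      using \<open>e \<in> mon_exps t\<close> by (cases e) (auto simp: mon_exps_def)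
    have "(\<lambda>v. dot (p0, q0, r0) v ^ a * dot (p1, q1, r1) v ^ b * dot (p2, q2, r2) v ^ c) \<in> PF (a + b + c)"
      by (intro PF_mult PF_power PF_dot)
    then show ?thesis
      by (simp add: fr e)
  qed
  then show ?thesis
    unfolding f eval_form_def by (intro PF_sum PF_scale)
qed

text \<open>Unlike the condition on Hasse derivatives, vanishing to order \<open>m\<close> along all lines through \<open>p\<close> is
  visibly invariant under linear changes of coordinates.\<close>

definition vord :: "nat \<Rightarrow> 'a::field vec3 \<Rightarrow> ('a vec3 \<Rightarrow> 'a) \<Rightarrow> bool" where
  "vord m p F \<longleftrightarrow> (\<forall>v. \<exists>q. \<forall>s. F (along p v s) = s ^ m * poly q s)"

lemma frame_along: "frame p q r (along x v s) = along (frame p q r x) (frame p q r v) s"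
  by (cases p; cases q; cases r; cases x; cases v) (simp add: algebra_simps)

lemma vord_frame: "vord m (frame p q r x) F \<Longrightarrow> vord m x (\<lambda>v. F (frame p q r v))"
  unfolding vord_def frame_along by blast

lemma vord_zero: "vord m p (\<lambda>v. 0)"
  unfolding vord_def by (auto intro!: exI[of _ 0])

lemma vord_add:
  assumes "vord m p F" "vord m p G"
  shows "vord m p (\<lambda>v. F v + G v)"
  unfolding vord_def
proof
  fix v
  obtain q r where "\<forall>s. F (along p v s) = s ^ m * poly q s" "\<forall>s. G (along p v s) = s ^ m * poly r s"
    using assms unfolding vord_def by metis
  then show "\<exists>q. \<forall>s. F (along p v s) + G (along p v s) = s ^ m * poly q s"
    by (intro exI[of _ "q + r"]) (simp add: algebra_simps)
qed

lemma vord_mult: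
  assumes "vord m p F" "vord n p G"
  shows "vord (m + n) p (\<lambda>v. F v * G v)"
  unfolding vord_def
proof
  fix v
  obtain q r where "\<forall>s. F (along p v s) = s ^ m * poly q s" "\<forall>s. G (along p v s) = s ^ n * poly r s"
    using assms unfolding vord_def by metis
  then show "\<exists>q. \<forall>s. F (along p v s) * G (along p v s) = s ^ (m + n) * poly q s"
    by (intro exI[of _ "q * r"]) (simp add: power_add algebra_simps)
qed

lemma vord_const: "vord 0 p (\<lambda>v. c)"
  unfolding vord_def by (auto intro!: exI[of _ "[:c:]"])

lemma vord_scale: "vord m p F \<Longrightarrow> vord m p (\<lambda>v. c * F v)"
  using vord_mult[OF vord_const, of m p F c] by simp

lemma dot_along: "dot l (along p v s) = dot l p + s * dot l v"
  by (cases l; cases p; cases v) (simp add: algebra_simps)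

lemma vord_dot: "vord 0 p (dot l)"
  unfolding vord_def
proof
  fix v
  show "\<exists>q. \<forall>s. dot l (along p v s) = s ^ 0 * poly q s"
    by (rule exI[of _ "[:dot l p, dot l v:]"]) (simp add: dot_along)
qed

lemma vord_dot_1: "dot l p = 0 \<Longrightarrow> vord (Suc 0) p (dot l)"
  unfolding vord_def
proof
  fix v assume "dot l p = 0"
  then show "\<exists>q. \<forall>s. dot l (along p v s) = s ^ Suc 0 * poly q s"
    by (intro exI[of _ "[:dot l v:]"]) (simp add: dot_along)
qed

section \<open>Taylor expansion: vanishing order against Hasse derivatives\<close>

lemma binomial_padded:
  fixes x y :: "'a::comm_ring_1"
  assumes "a \<le> t"
  shows "(x + y) ^ a = (\<Sum>g\<le>t. of_nat (a choose g) * x ^ (a - g) * y ^ g)"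
proof -
  have "(x + y) ^ a = (\<Sum>g\<le>a. of_nat (a choose g) * x ^ (a - g) * y ^ g)"
    by (subst add.commute, subst binomial_ring) (simp add: mult_ac)
  also have "\<dots> = (\<Sum>g\<le>t. of_nat (a choose g) * x ^ (a - g) * y ^ g)"
    using assms by (intro sum.mono_neutral_left) (auto simp: binomial_eq_0)
  finally show ?thesis .
qed

abbreviation box :: "nat \<Rightarrow> (nat \<times> nat \<times> nat) set" where
  "box t \<equiv> {..t} \<times> {..t} \<times> {..t}"

fun esum :: "nat \<times> nat \<times> nat \<Rightarrow> nat" where
  "esum (a, b, c) = a + b + c"

lemma sum_triple: "(\<Sum>g\<in>A \<times> B \<times> C. G g) = (\<Sum>a\<in>A. \<Sum>b\<in>B. \<Sum>c\<in>C. G (a, b, c))"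
  unfolding sum.cartesian_product by (rule sum.cong) auto

lemma taylor:
  "eval_form t f (along p v s) = (\<Sum>g\<in>box t. hasse t f p g * mon_val g v * s ^ esum g)"
proof -
  obtain p0 p1 p2 v0 v1 v2 where pv: "p = (p0, p1, p2)" "v = (v0, v1, v2)"
    by (metis prod_cases3)
  define H where "H e g = (case e of (a,b,c) \<Rightarrow> case g of (g0,g1,g2) \<Rightarrow>
        f e * of_nat ((a choose g0) * (b choose g1) * (c choose g2))
          * p0 ^ (a - g0) * p1 ^ (b - g1) * p2 ^ (c - g2))" for e g
  have hasse: "hasse t f p g = (\<Sum>e\<in>mon_exps t. H e g)" for g
    unfolding hasse_def H_def pv by (auto intro!: sum.cong)
  have "f e * mon_val e (along p v s) = (\<Sum>g\<in>box t. H e g * mon_val g v * s ^ esum g)"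
    if "e \<in> mon_exps t" for e
  proof -
    obtain a b c where e: "e = (a, b, c)" "a \<le> t" "b \<le> t" "c \<le> t"
      using \<open>e \<in> mon_exps t\<close> by (auto simp: mon_exps_def)
    \<comment> \<open>All binomial expansions are padded to the range \<open>{..t}\<close>, so the
      index set \<open>box t\<close> does not depend on \<open>e\<close> and the two sums can be
      exchanged afterwards.\<close>
    have "f e * mon_val e (along p v s) =
      f e * ((\<Sum>g\<le>t. of_nat (a choose g) * p0 ^ (a - g) * (s * v0) ^ g)
        * ((\<Sum>g\<le>t. of_nat (b choose g) * p1 ^ (b - g) * (s * v1) ^ g)
        * (\<Sum>g\<le>t. of_nat (c choose g) * p2 ^ (c - g) * (s * v2) ^ g)))"
      by (simp only: pv e(1) along.simps mon_val.simps mult.assoc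
        binomial_padded[OF e(2), of p0 "s * v0"] binomial_padded[OF e(3), of p1 "s * v1"]
        binomial_padded[OF e(4), of p2 "s * v2"])
    also have "\<dots> = (\<Sum>g0\<le>t. \<Sum>g1\<le>t. \<Sum>g2\<le>t. f e * ((of_nat (a choose g0) * p0 ^ (a - g0) * (s * v0) ^ g0)
        * ((of_nat (b choose g1) * p1 ^ (b - g1) * (s * v1) ^ g1)
        * (of_nat (c choose g2) * p2 ^ (c - g2) * (s * v2) ^ g2))))"
      by (simp only: sum_product) (simp only: sum_distrib_left)
    also have "\<dots> = (\<Sum>g\<in>box t. H e g * mon_val g v * s ^ esum g)"
      unfolding sum_triple
      by (intro sum.cong refl) (simp only: H_def pv e prod.case mon_val.simps esum.simps of_nat_mult
          power_add power_mult_distrib mult_ac)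
    finally show ?thesis .
  qed
  then have "eval_form t f (along p v s) = (\<Sum>e\<in>mon_exps t. \<Sum>g\<in>box t. H e g * mon_val g v * s ^ esum g)"
    by (simp add: eval_form_def)
  also have "\<dots> = (\<Sum>g\<in>box t. hasse t f p g * mon_val g v * s ^ esum g)"
    by (subst sum.swap) (simp add: hasse sum_distrib_right)
  finally show ?thesis .
qed

lemma hasse_eq_0_outside: "t < esum g \<Longrightarrow> hasse t f p g = 0"
  unfolding hasse_def
proof (rule sum.neutral, rule ballI)
  fix e assume "t < esum g" "e \<in> mon_exps t"
  moreover obtain a b c g0 g1 g2 where eg: "e = (a, b, c)" "g = (g0, g1, g2)"
    by (metis prod_cases3)
  ultimately have "a < g0 \<or> b < g1 \<or> c < g2"
    by (auto simp: mon_exps_def)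
  then show "(case e of (a, b, c) \<Rightarrow> case g of (g0, g1, g2) \<Rightarrow> case p of (p0, p1, p2) \<Rightarrow>
      f e * of_nat ((a choose g0) * (b choose g1) * (c choose g2))
        * p0 ^ (a - g0) * p1 ^ (b - g1) * p2 ^ (c - g2)) = 0"
    by (cases p) (elim disjE; simp add: eg binomial_eq_0)
qed

text \<open>By \<open>taylor\<close>, the coefficient of s^k in f(p + s v) is the degree k part of
  f(p + y) evaluated at y = v. It vanishes for all \<open>v\<close> exactly if all Hasse derivatives
  of order k vanish at \<open>p\<close>, in any characteristic.\<close>

lemma vord_iff_in_fat_ideal:
  fixes f :: "nat \<times> nat \<times> nat \<Rightarrow> 'a::alg_closed_field"
  shows "vord m p (eval_form t f) \<longleftrightarrow> in_fat_ideal t m p f"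
proof
  assume L: "in_fat_ideal t m p f"
  show "vord m p (eval_form t f)"
    unfolding vord_def
  proof
    fix v
    let ?q = "\<Sum>g\<in>box t. if esum g < m then 0 else monom (hasse t f p g * mon_val g v) (esum g - m)"
    have "hasse t f p g * mon_val g v * s ^ esum g =
      s ^ m * poly (if esum g < m then 0 else monom (hasse t f p g * mon_val g v) (esum g - m)) s" for s g
    proof (cases "esum g < m")
      case True
      then have "hasse t f p g = 0"
        using L unfolding in_fat_ideal_def by (cases g) auto
      then show ?thesis
        using True by simp
    next
      case False
      then have "s ^ esum g = s ^ m * s ^ (esum g - m)"
        by (simp flip: power_add)
      then show ?thesis
        using False by (simp add: poly_monom mult_ac)
    qed
    then have "eval_form t f (along p v s) = s ^ m * poly ?q s" for s
      by (simp add: taylor poly_sum sum_distrib_left)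
    then show "\<exists>q. \<forall>s. eval_form t f (along p v s) = s ^ m * poly q s"
      by blast
  qed
next
  assume R: "vord m p (eval_form t f)"
  have "hasse t f p g = 0" if "esum g < m" for g
  proof (cases "esum g \<le> t")
    case False
    then show ?thesis
      by (simp add: hasse_eq_0_outside)
  next
    case True
    have "eval_form (esum g) (hasse t f p) v = 0" for v
    proof -
      obtain q where q: "\<And>s. eval_form t f (along p v s) = s ^ m * poly q s"
        using R unfolding vord_def by meson
      \<comment> \<open>Both sides are polynomials in s; comparing the coefficient at an exponent
        below \<open>m\<close> isolates one homogeneous part of the Taylor expansion.\<close>
      have "(\<Sum>g\<in>box t. monom (hasse t f p g * mon_val g v) (esum g)) = monom 1 m * q"
        by (rule poly_eqI_fun) (simp add: poly_sum poly_monom taylor[symmetric] q)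
      then have "coeff (\<Sum>g\<in>box t. monom (hasse t f p g * mon_val g v) (esum g)) (esum g) = 0"
        using \<open>esum g < m\<close> by (simp add: coeff_monom_mult)
      then have "(\<Sum>h\<in>box t. if esum h = esum g then hasse t f p h * mon_val h v else 0) = 0"
        by (simp add: coeff_sum)
      moreover have "(\<Sum>h\<in>box t. if esum h = esum g then hasse t f p h * mon_val h v else 0) =
        (\<Sum>h\<in>mon_exps (esum g). hasse t f p h * mon_val h v)"
        using True by (intro sum.mono_neutral_cong_right) (auto simp: mon_exps_def)
      ultimately show ?thesis
        by (simp add: eval_form_def)
    qed
    then show ?thesis
      by (rule eval_form_zero_imp) (cases g; simp add: mon_exps_def)
  qed
  then show "in_fat_ideal t m p f"
    unfolding in_fat_ideal_def by (metis esum.simps)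
qed

text \<open>At (1, 0, 0) a binomial coefficient or a power of 0 kills every monomial whose y- and
  z-exponents differ from \<open>b\<close> and \<open>c\<close>.\<close>

lemma hasse_e0:
  assumes "b + c \<le> t"
  shows "hasse t f (1, 0, 0) (0, b, c) = f (t - b - c, b, c)"
proof -
  have "hasse t f (1, 0, 0) (0, b, c) = (\<Sum>e\<in>mon_exps t. if e = (t - b - c, b, c) then f e else 0)"
    unfolding hasse_def
  proof (rule sum.cong[OF refl])
    fix e assume "e \<in> mon_exps t"
    then obtain a' b' c' where e: "e = (a', b', c')" "a' + b' + c' = t"
      by (auto simp: mon_exps_def)
    consider "b' < b \<or> c' < c" | "b' = b" "c' = c" | "b' > b \<or> c' > c"
      by linarith
    then show "(case e of (a, b', c') \<Rightarrow> case (0, b, c) of (g0, g1, g2) \<Rightarrow> case (1, 0, 0) of (p0, p1, p2) \<Rightarrow>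
        f e * of_nat ((a choose g0) * (b' choose g1) * (c' choose g2)) * p0 ^ (a - g0) * p1 ^ (b' - g1) * p2 ^ (c' - g2))
      = (if e = (t - b - c, b, c) then f e else 0)"
      by cases (use e in \<open>auto simp: binomial_eq_0\<close>)
  qed
  also have "\<dots> = f (t - b - c, b, c)"
    using assms by (subst sum.delta[OF finite_mon_exps]) (auto simp: mon_exps_def)
  finally show ?thesis .
qed

text \<open>In the chart x = 1 the point is the origin and b + c is the affine degree of a monomial.
  This turns vanishing to order \<open>m\<close> into explicit conditions on coefficients.\<close>

lemma vord_e0_iff:
  fixes f :: "nat \<times> nat \<times> nat \<Rightarrow> 'a::alg_closed_field"
  shows "vord m (1, 0, 0) (eval_form t f) \<longleftrightarrow> (\<forall>a b c. a + b + c = t \<longrightarrow> b + c < m \<longrightarrow> f (a, b, c) = 0)"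
  unfolding vord_iff_in_fat_ideal
proof (intro iffI allI impI)
  fix a b c assume "in_fat_ideal t m (1, 0, 0) f" "a + b + c = t" "b + c < m"
  then show "f (a, b, c) = 0"
    using hasse_e0[of b c t f] by (fastforce simp: in_fat_ideal_def)
next
  assume *: "\<forall>a b c. a + b + c = t \<longrightarrow> b + c < m \<longrightarrow> f (a, b, c) = 0"
  have "hasse t f (1, 0, 0) (g0, g1, g2) = 0" if "g0 + g1 + g2 < m" for g0 g1 g2
    unfolding hasse_def
  proof (rule sum.neutral, rule ballI)
    fix e assume "e \<in> mon_exps t"
    then obtain a' b' c' where e: "e = (a', b', c')" "a' + b' + c' = t"
      by (auto simp: mon_exps_def)
    consider "b' < g1 \<or> c' < g2" | "b' \<le> g1" "c' \<le> g2" | "b' > g1 \<or> c' > g2"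
      by linarith
    then show "(case e of (a, b', c') \<Rightarrow> case (g0, g1, g2) of (g0, g1, g2) \<Rightarrow> case (1, 0, 0) of (p0, p1, p2) \<Rightarrow>
        f e * of_nat ((a choose g0) * (b' choose g1) * (c' choose g2)) * p0 ^ (a - g0) * p1 ^ (b' - g1) * p2 ^ (c' - g2)) = 0"
      by cases (use e * that in \<open>auto simp: binomial_eq_0\<close>)
  qed
  then show "in_fat_ideal t m (1, 0, 0) f"
    by (simp add: in_fat_ideal_def)
qed

section \<open>Coordinates adapted to a point and a line\<close>

lemma frame_inverse:
  assumes "det3 p q r \<noteq> 0"
  obtains p' q' r' where "\<And>v. frame p q r (frame p' q' r' v) = v" "\<And>v. frame p' q' r' (frame p q r v) = v"
proof -
  obtain p0 p1 p2 q0 q1 q2 r0 r1 r2 where pqr: "p = (p0, p1, p2)" "q = (q0, q1, q2)" "r = (r0, r1, r2)"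
    by (metis prod_cases3)
  define D where "D = det3 p q r"
  have D: "D = p0 * (q1 * r2 - q2 * r1) + p1 * (q2 * r0 - q0 * r2) + p2 * (q0 * r1 - q1 * r0)"
    by (simp add: D_def pqr)
  \<comment> \<open>The columns of the adjugate matrix; dividing by the determinant \<open>D\<close>
    is postponed so that both products are polynomial identities.\<close>
  define a b c where "a = (q1 * r2 - q2 * r1, r1 * p2 - r2 * p1, p1 * q2 - p2 * q1)"
    and "b = (q2 * r0 - q0 * r2, r2 * p0 - r0 * p2, p2 * q0 - p0 * q2)"
    and "c = (q0 * r1 - q1 * r0, r0 * p1 - r1 * p0, p0 * q1 - p1 * q0)"
  have 1: "frame p q r (frame a b c v) = vsc D v" for v
    by (cases v) (simp add: pqr a_def b_def c_def D algebra_simps)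
  have 2: "frame a b c (frame p q r v) = vsc D v" for v
    by (cases v) (simp add: pqr a_def b_def c_def D algebra_simps)
  have sc: "frame (vsc (inverse D) a) (vsc (inverse D) b) (vsc (inverse D) c) v = vsc (inverse D) (frame a b c v)" for v
    by (cases v; cases a; cases b; cases c) (simp add: algebra_simps)
  have fsc: "frame p q r (vsc k v) = vsc k (frame p q r v)" for k v
    by (cases v) (simp add: pqr algebra_simps)
  have inv: "vsc (inverse D) (vsc D v) = v" for v
    using assms by (cases v) (simp add: D_def flip: mult.assoc)
  show thesis
    by (rule that[of "vsc (inverse D) a" "vsc (inverse D) b" "vsc (inverse D) c"])
      (simp_all only: sc fsc 1 2 inv)
qed

lemma dot_frame: "dot l (frame p q r (x, y, z)) = x * dot l p + y * dot l q + z * dot l r"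
  by (cases l; cases p; cases q; cases r) (simp add: algebra_simps)

lemma frame_e0: "frame p q r (1, 0, 0) = p"
  by (cases p; cases q; cases r) simp

lemma dot_cross_self: "dot (cross u w) u = 0" "dot (cross u w) w = 0"
proof -
  have *: "(b * z - c * y) * a + (c * x - a * z) * b + (a * y - b * x) * c = 0"
    "(b * z - c * y) * x + (c * x - a * z) * y + (a * y - b * x) * z = 0" for a b c x y z :: 'a
    by algebra+
  show "dot (cross u w) u = 0" "dot (cross u w) w = 0"
    by (cases u; cases w; simp only: cross.simps dot.simps *)+
qed

lemma det3_swap: "det3 p q r = - dot (cross p r) q"
proof -
  have *: "a * (d * i - e * h) + b * (e * g - c * i) + f * (c * h - d * g) =
    - ((b * i - f * h) * c + (f * g - a * i) * d + (a * h - b * g) * e)" for a b c d e f g h i :: 'a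
    by algebra
  show ?thesis
    by (cases p; cases q; cases r) (simp only: cross.simps dot.simps *)
qed

lemma dot_commute: "dot u v = dot v u"
  by (cases u; cases v) (simp add: mult.commute)

text \<open>Over the reals r = (l x p) / (p . p) would do, but p . p may vanish here; hence one
  division by a nonzero coordinate of \<open>p\<close> per case.\<close>

lemma cross_solve:
  assumes "p \<noteq> (0, 0, 0)" "dot l p = 0"
  obtains r where "cross p r = l"
proof -
  obtain p0 p1 p2 l0 l1 l2 where pl: "p = (p0, p1, p2)" "l = (l0, l1, l2)"
    by (metis prod_cases3)
  have d: "l0 * p0 + l1 * p1 + l2 * p2 = 0"
    using assms(2) by (simp add: pl)
  consider "p0 \<noteq> 0" | "p1 \<noteq> 0" | "p2 \<noteq> 0"
    using assms(1) pl by auto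
  then show thesis
  proof cases
    case 1
    have "- (p1 * l1 + p2 * l2) = l0 * p0"
      using d by (simp add: neg_eq_iff_add_eq_0 algebra_simps)
    then have "- (p1 * l1 + p2 * l2) / p0 = l0"
      using 1 by simp
    then have "p1 * (- l1 / p0) - p2 * (l2 / p0) = l0"
      by (simp add: diff_divide_distrib)
    then show thesis
      using 1 by (intro that[of "(0, l2 / p0, - l1 / p0)"]) (simp add: pl)
  next
    case 2
    have "- (p2 * l2 + p0 * l0) = l1 * p1"
      using d by (simp add: neg_eq_iff_add_eq_0 algebra_simps)
    then have "- (p2 * l2 + p0 * l0) / p1 = l1"
      using 2 by simp
    then have "p2 * (- l2 / p1) - p0 * (l0 / p1) = l1"
      by (simp add: diff_divide_distrib)
    then show thesis
      using 2 by (intro that[of "(- l2 / p1, 0, l0 / p1)"]) (simp add: pl)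
  next
    case 3
    have "- (p0 * l0 + p1 * l1) = l2 * p2"
      using d by (simp add: neg_eq_iff_add_eq_0 algebra_simps)
    then have "- (p0 * l0 + p1 * l1) / p2 = l2"
      using 3 by simp
    then have "p0 * (- l0 / p2) - p1 * (l1 / p2) = l2"
      by (simp add: diff_divide_distrib)
    then show thesis
      using 3 by (intro that[of "(l1 / p2, - l0 / p2, 0)"]) (simp add: pl)
  qed
qed

lemma dot_eq_1:
  assumes "l \<noteq> (0, 0, 0)"
  obtains q where "dot l q = 1"
proof -
  obtain l0 l1 l2 where l: "l = (l0, l1, l2)"
    by (metis prod_cases3)
  consider "l0 \<noteq> 0" | "l1 \<noteq> 0" | "l2 \<noteq> 0"
    using assms l by auto
  then show thesis
    by cases (use that[of "(1 / l0, 0, 0)"] that[of "(0, 1 / l1, 0)"] that[of "(0, 0, 1 / l2)"] in \<open>auto simp: l\<close>)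
qed

text \<open>The vectors \<open>u\<close> and \<open>w\<close> span the plane l = 0, so they
  parametrize the line, and \<open>det3 q u w = dot q l\<close> tells when \<open>q\<close>
  completes them to a frame.\<close>

lemma line_basis:
  assumes "l \<noteq> (0, 0, 0)"
  obtains u w where "cross u w = l"
proof -
  obtain l0 l1 l2 where l: "l = (l0, l1, l2)"
    by (metis prod_cases3)
  obtain u where "u \<noteq> (0, 0, 0)" "dot l u = 0"
  proof (cases "l0 = 0 \<and> l1 = 0")
    case True
    then show thesis
      using that[of "(1, 0, 0)"] by (simp add: l)
  next
    case False
    then show thesis
      using that[of "(- l1, l0, 0)"] by (auto simp: l)
  qed
  then show thesis
    using that cross_solve by metis
qed

lemma frame_at_point:
  assumes "p \<noteq> (0, 0, 0)"
  obtains q r where "det3 p q r \<noteq> 0"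
proof -
  obtain l where l: "dot p l = 1"
    using dot_eq_1[OF assms] .
  then have "l \<noteq> (0, 0, 0)"
    by (cases p) auto
  then obtain q r where "cross q r = l"
    by (rule line_basis)
  then show thesis
    using l that[of q r] by simp
qed

section \<open>Forms along lines, and division by a linear form\<close>

lemma PF_poly:
  assumes "F \<in> PF t"
  obtains q where "\<And>s. F (along p v s) = poly q s"
proof -
  obtain f where f: "F = eval_form t f"
    using assms by (auto simp: PF_def)
  have "F (along p v s) = poly (\<Sum>g\<in>box t. monom (hasse t f p g * mon_val g v) (esum g)) s" for s
    by (simp add: f taylor poly_sum poly_monom)
  then show thesis
    using that by blast
qed

lemma vord_0: "F \<in> PF t \<Longrightarrow> vord 0 p F"
  unfolding vord_def by (metis PF_poly power_0 mult_1)

lemma PF_homogeneous: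
  assumes "F \<in> PF t"
  shows "F (vsc c v) = c ^ t * F v"
proof -
  obtain f where f: "F = eval_form t f"
    using assms by (auto simp: PF_def)
  have "mon_val e (vsc c v) = c ^ t * mon_val e v" if "e \<in> mon_exps t" for e
    using that by (cases v) (auto simp: mon_exps_def power_mult_distrib power_add)
  then show ?thesis
    by (simp add: f eval_form_def sum_distrib_left mult_ac)
qed

text \<open>A polynomial identity on all but one parameter value extends: multiplied by s - a, the
  polynomial vanishes everywhere.\<close>

lemma PF_vanish_extend:
  fixes F :: "'a::alg_closed_field vec3 \<Rightarrow> 'a"
  assumes "F \<in> PF t" "\<And>s. s \<noteq> a \<Longrightarrow> F (along p v s) = 0"
  shows "F (along p v s) = 0"
proof -
  obtain q where q: "\<And>s. F (along p v s) = poly q s"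
    using PF_poly[OF assms(1)] by blast
  have "[:- a, 1:] * q = 0"
  proof (rule poly_eqI_fun)
    fix x
    show "poly ([:- a, 1:] * q) x = poly 0 x"
      using assms(2)[of x] by (cases "x = a") (simp_all add: q)
  qed
  then have "q = 0"
    by (metis mult_eq_0_iff pCons_eq_0_iff zero_neq_one)
  then show ?thesis
    by (simp add: q)
qed

lemma along_0: "along p v 0 = p"
  by (cases p; cases v) simp

lemma PF_vanish_off_line:
  fixes F :: "'a::alg_closed_field vec3 \<Rightarrow> 'a"
  assumes "F \<in> PF t" "l \<noteq> (0, 0, 0)" "\<And>v. dot l v \<noteq> 0 \<Longrightarrow> F v = 0"
  shows "F v = 0"
proof (cases "dot l v = 0")
  case True
  obtain q where q: "dot l q = 1"
    using dot_eq_1[OF assms(2)] .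
  have "F (along v q s) = 0" if "s \<noteq> 0" for s
    using that by (intro assms(3)) (simp add: dot_along True q)
  then show ?thesis
    using PF_vanish_extend[OF assms(1), of 0 v q 0] by (simp add: along_0)
qed (use assms in auto)

text \<open>In adapted coordinates the equation of a line is a coordinate, and multiplying by it
  only shifts exponents; cancelling it can then be checked on coefficients.\<close>

lemma eval_form_shift_x:
  "eval_form (Suc t) (\<lambda>(a, b, c). if a = 0 then 0 else g (a - 1, b, c)) (x, y, z) = x * eval_form t g (x, y, z)"
proof -
  have "x * eval_form t g (x, y, z) = (\<Sum>e\<in>mon_exps t. x * (g e * mon_val e (x, y, z)))"
    by (simp add: eval_form_def sum_distrib_left)
  also have "\<dots> = eval_form (Suc t) (\<lambda>(a, b, c). if a = 0 then 0 else g (a - 1, b, c)) (x, y, z)"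
    unfolding eval_form_def
  proof (rule sym, rule trans)
    let ?h = "\<lambda>(a, b, c). (Suc a, b, c)"
    let ?G = "\<lambda>e. (case e of (a, b, c) \<Rightarrow> if a = 0 then 0 else g (a - 1, b, c)) * mon_val e (x, y, z)"
    show "sum ?G (mon_exps (Suc t)) = sum ?G (?h ` mon_exps t)"
    proof (rule sum.mono_neutral_right)
      show "\<forall>e\<in>mon_exps (Suc t) - ?h ` mon_exps t. ?G e = 0"
      proof
        fix e assume e: "e \<in> mon_exps (Suc t) - ?h ` mon_exps t"
        obtain a b c where abc: "e = (a, b, c)"
          by (metis prod_cases3)
        have "a = 0"
        proof (rule ccontr)
          assume "a \<noteq> 0"
          then have "e \<in> ?h ` mon_exps t"
            using e by (intro image_eqI[of _ _ "(a - 1, b, c)"]) (auto simp: abc mon_exps_def)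
          then show False
            using e by simp
        qed
        then show "?G e = 0"
          by (simp add: abc)
      qed
    qed (rule finite_mon_exps, auto simp: mon_exps_def)
    show "sum ?G (?h ` mon_exps t) = (\<Sum>e\<in>mon_exps t. x * (g e * mon_val e (x, y, z)))"
      by (subst sum.reindex) (auto simp: inj_on_def intro!: sum.cong)
  qed
  finally show ?thesis ..
qed

lemma eval_form_shift_y:
  "eval_form (Suc t) (\<lambda>(a, b, c). if b = 0 then 0 else g (a, b - 1, c)) (x, y, z) = y * eval_form t g (x, y, z)"
proof -
  have "y * eval_form t g (x, y, z) = (\<Sum>e\<in>mon_exps t. y * (g e * mon_val e (x, y, z)))"
    by (simp add: eval_form_def sum_distrib_left)
  also have "\<dots> = eval_form (Suc t) (\<lambda>(a, b, c). if b = 0 then 0 else g (a, b - 1, c)) (x, y, z)"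
    unfolding eval_form_def
  proof (rule sym, rule trans)
    let ?h = "\<lambda>(a, b, c). (a, Suc b, c)"
    let ?G = "\<lambda>e. (case e of (a, b, c) \<Rightarrow> if b = 0 then 0 else g (a, b - 1, c)) * mon_val e (x, y, z)"
    show "sum ?G (mon_exps (Suc t)) = sum ?G (?h ` mon_exps t)"
    proof (rule sum.mono_neutral_right)
      show "\<forall>e\<in>mon_exps (Suc t) - ?h ` mon_exps t. ?G e = 0"
      proof
        fix e assume e: "e \<in> mon_exps (Suc t) - ?h ` mon_exps t"
        obtain a b c where abc: "e = (a, b, c)"
          by (metis prod_cases3)
        have "b = 0"
        proof (rule ccontr)
          assume "b \<noteq> 0"
          then have "e \<in> ?h ` mon_exps t"
            using e by (intro image_eqI[of _ _ "(a, b - 1, c)"]) (auto simp: abc mon_exps_def)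
          then show False
            using e by simp
        qed
        then show "?G e = 0"
          by (simp add: abc)
      qed
    qed (rule finite_mon_exps, auto simp: mon_exps_def)
    show "sum ?G (?h ` mon_exps t) = (\<Sum>e\<in>mon_exps t. y * (g e * mon_val e (x, y, z)))"
      by (subst sum.reindex) (auto simp: inj_on_def intro!: sum.cong)
  qed
  finally show ?thesis ..
qed

lemma vord_frame_inverse:
  assumes "\<And>v. frame p q r (frame p' q' r' v) = v" "\<And>v. frame p' q' r' (frame p q r v) = v"
    "vord m x (\<lambda>v. F (frame p q r v))"
  shows "vord m (frame p q r x) F"
  using vord_frame[of m p' q' r' "frame p q r x" "\<lambda>v. F (frame p q r v)"] assms by simp

text \<open>The frame \<open>p\<close>, \<open>q\<close>, \<open>r\<close> puts \<open>p\<close> at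
  (1, 0, 0) and makes \<open>l\<close> the coordinate y. Cancelling y lowers b + c by exactly
  one.\<close>

lemma vord_cancel_through:
  fixes F :: "'a::alg_closed_field vec3 \<Rightarrow> 'a"
  assumes F: "F \<in> PF t" and p: "p \<noteq> (0, 0, 0)" "dot l p = 0" and l: "l \<noteq> (0, 0, 0)"
    and ord: "vord (Suc m) p (\<lambda>v. dot l v * F v)"
  shows "vord m p F"
proof -
  obtain r where r: "cross p r = l"
    using cross_solve[OF p] .
  obtain q where q: "dot l q = 1"
    using dot_eq_1[OF l] .
  have "det3 p q r \<noteq> 0"
    unfolding det3_swap by (simp add: r q)
  then obtain p' q' r' where inv: "\<And>v. frame p q r (frame p' q' r' v) = v" "\<And>v. frame p' q' r' (frame p q r v) = v"
    by (rule frame_inverse) (rule that)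
  have lr: "dot l r = 0"
    using r dot_cross_self by metis
  obtain g where g: "(\<lambda>v. F (frame p q r v)) = eval_form t g"
    using PF_frame[OF F, of p q r] by (auto simp: PF_def)
  have "vord (Suc m) (1, 0, 0) (\<lambda>v. dot l (frame p q r v) * F (frame p q r v))"
    using ord vord_frame[of "Suc m" p q r "(1, 0, 0)" "\<lambda>v. dot l v * F v"] by (simp add: frame_e0)
  also have "(\<lambda>v. dot l (frame p q r v) * F (frame p q r v)) =
    eval_form (Suc t) (\<lambda>(a, b, c). if b = 0 then 0 else g (a, b - 1, c))"
  proof
    fix v :: "'a vec3"
    show "dot l (frame p q r v) * F (frame p q r v) =
      eval_form (Suc t) (\<lambda>(a, b, c). if b = 0 then 0 else g (a, b - 1, c)) v"
      using fun_cong[OF g, of v] by (cases v) (simp add: dot_frame p q lr eval_form_shift_y)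
  qed
  finally have *: "a + b + c = Suc t \<Longrightarrow> b + c < Suc m \<Longrightarrow>
      (case (a, b, c) of (a, b, c) \<Rightarrow> if b = 0 then 0 else g (a, b - 1, c)) = 0" for a b c
    unfolding vord_e0_iff by blast
  have "g (a, b, c) = 0" if "a + b + c = t" "b + c < m" for a b c
    using *[of a "Suc b" c] that by simp
  then have "vord m (1, 0, 0) (\<lambda>v. F (frame p q r v))"
    unfolding g vord_e0_iff by blast
  from vord_frame_inverse[OF inv this] show ?thesis
    by (simp add: frame_e0)
qed

text \<open>With \<open>q\<close> and \<open>r\<close> spanning the line, \<open>l\<close> becomes a
  nonzero multiple of x. Cancelling x leaves b + c, and hence the order at (1, 0, 0),
  unchanged.\<close>

lemma vord_cancel_off:
  fixes F :: "'a::alg_closed_field vec3 \<Rightarrow> 'a"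
  assumes F: "F \<in> PF t" and p: "dot l p \<noteq> 0"
    and ord: "vord m p (\<lambda>v. dot l v * F v)"
  shows "vord m p F"
proof -
  have "l \<noteq> (0, 0, 0)"
    using p by (cases p) auto
  then obtain q r where qr: "cross q r = l"
    by (rule line_basis)
  have "det3 p q r \<noteq> 0"
    using p by (simp add: qr dot_commute[of p])
  then obtain p' q' r' where inv: "\<And>v. frame p q r (frame p' q' r' v) = v" "\<And>v. frame p' q' r' (frame p q r v) = v"
    by (rule frame_inverse) (rule that)
  have lqr: "dot l q = 0" "dot l r = 0"
    using qr dot_cross_self by metis+
  obtain g where g: "(\<lambda>v. F (frame p q r v)) = eval_form t g"
    using PF_frame[OF F, of p q r] by (auto simp: PF_def)
  have "vord m (1, 0, 0) (\<lambda>v. dot l (frame p q r v) * F (frame p q r v))"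
    using ord vord_frame[of m p q r "(1, 0, 0)" "\<lambda>v. dot l v * F v"] by (simp add: frame_e0)
  from vord_scale[OF this, of "1 / dot l p"]
  have "vord m (1, 0, 0) (\<lambda>v. 1 / dot l p * (dot l (frame p q r v) * F (frame p q r v)))" .
  also have "(\<lambda>v. 1 / dot l p * (dot l (frame p q r v) * F (frame p q r v))) =
    eval_form (Suc t) (\<lambda>(a, b, c). if a = 0 then 0 else g (a - 1, b, c))"
  proof
    fix v :: "'a vec3"
    show "1 / dot l p * (dot l (frame p q r v) * F (frame p q r v)) =
      eval_form (Suc t) (\<lambda>(a, b, c). if a = 0 then 0 else g (a - 1, b, c)) v"
      using fun_cong[OF g, of v] p by (cases v) (simp add: dot_frame lqr eval_form_shift_x)
  qed
  finally have *: "a + b + c = Suc t \<Longrightarrow> b + c < m \<Longrightarrow>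
      (case (a, b, c) of (a, b, c) \<Rightarrow> if a = 0 then 0 else g (a - 1, b, c)) = 0" for a b c
    unfolding vord_e0_iff by blast
  have "g (a, b, c) = 0" if "a + b + c = t" "b + c < m" for a b c
    using *[of "Suc a" b c] that by simp
  then have "vord m (1, 0, 0) (\<lambda>v. F (frame p q r v))"
    unfolding g vord_e0_iff by blast
  from vord_frame_inverse[OF inv this] show ?thesis
    by (simp add: frame_e0)
qed

text \<open>In a frame with \<open>l\<close> as coordinate x, vanishing on the line says that no
  monomial without x occurs. The first alternative covers constants, for which no quotient degree
  exists.\<close>

lemma PF_divide:
  fixes F :: "'a::alg_closed_field vec3 \<Rightarrow> 'a"
  assumes F: "F \<in> PF t" and l: "l \<noteq> (0, 0, 0)" and vanish: "\<And>v. dot l v = 0 \<Longrightarrow> F v = 0"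
  shows "F = (\<lambda>v. 0) \<or> (\<exists>t' F'. t = Suc t' \<and> F' \<in> PF t' \<and> F = (\<lambda>v. dot l v * F' v))"
proof -
  obtain u w where uw: "cross u w = l"
    using line_basis[OF l] .
  obtain q where q: "dot l q = 1"
    using dot_eq_1[OF l] .
  have "det3 q u w \<noteq> 0"
    using q by (simp add: uw dot_commute[of q])
  then obtain p' q' r' where inv: "\<And>v. frame q u w (frame p' q' r' v) = v" "\<And>v. frame p' q' r' (frame q u w v) = v"
    by (rule frame_inverse) (rule that)
  have luw: "dot l u = 0" "dot l w = 0"
    using uw dot_cross_self by metis+
  obtain g where g: "(\<lambda>v. F (frame q u w v)) = eval_form t g"
    using PF_frame[OF F, of q u w] by (auto simp: PF_def)
  have zero: "eval_form t g (0, y, z) = 0" for y z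
    unfolding fun_cong[OF g, symmetric] by (rule vanish) (simp add: dot_frame luw)
  have g0: "g (0, b, c) = 0" if "b + c = t" for b c
  proof -
    have "eval_form t (\<lambda>(a, b, c). if a = 0 then g (a, b, c) else 0) (x, y, z) = eval_form t g (0, y, z)" for x y z
      unfolding eval_form_def by (rule sum.cong) auto
    then have "eval_form t (\<lambda>(a, b, c). if a = 0 then g (a, b, c) else 0) v = 0" for v
      by (cases v) (simp add: zero)
    from eval_form_zero_imp[OF this, of "(0, b, c)"] that show ?thesis
      by (simp add: mon_exps_def)
  qed
  show ?thesis
  proof (cases t)
    case 0
    have "F v = 0" for v
    proof -
      have "eval_form t g x = 0" for x
        using g0[of 0 0] by (simp add: 0 eval_form_def mon_exps_def)
      then show ?thesis
        using fun_cong[OF g, of "frame p' q' r' v"] by (simp add: inv)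
    qed
    then show ?thesis
      by blast
  next
    case (Suc t')
    define G where "G = eval_form t' (\<lambda>(a, b, c). g (Suc a, b, c))"
    have G: "eval_form t g (x, y, z) = x * G (x, y, z)" for x y z
    proof -
      have "x * G (x, y, z) =
        eval_form (Suc t') (\<lambda>(a, b, c). if a = 0 then 0 else g (Suc (a - 1), b, c)) (x, y, z)"
        unfolding G_def eval_form_shift_x[symmetric] by (simp only: prod.case)
      also have "\<dots> = eval_form t g (x, y, z)"
        unfolding eval_form_def Suc
      proof (rule sum.cong[OF refl])
        fix e assume "e \<in> mon_exps (Suc t')"
        then obtain a b c where e: "e = (a, b, c)" "a + b + c = t"
          by (auto simp: mon_exps_def Suc)
        show "(case e of (a, b, c) \<Rightarrow> if a = 0 then 0 else g (Suc (a - 1), b, c)) * mon_val e (x, y, z)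
          = g e * mon_val e (x, y, z)"
          using g0[of b c] e(2) by (cases a) (simp_all add: e(1))
      qed
      finally show ?thesis ..
    qed
    have "F v = dot l v * G (frame p' q' r' v)" for v
    proof -
      obtain x y z where xyz: "frame p' q' r' v = (x, y, z)"
        by (metis prod_cases3)
      have "dot l v = dot l (frame q u w (x, y, z))"
        by (metis inv(1) xyz)
      also have "\<dots> = x"
        by (simp add: dot_frame q luw)
      finally show ?thesis
        using fun_cong[OF g, of "(x, y, z)"] G[of x y z] inv(1)[of v] by (simp add: xyz)
    qed
    moreover have "(\<lambda>v. G (frame p' q' r' v)) \<in> PF t'"
      by (intro PF_frame) (simp add: G_def PF_def)
    ultimately show ?thesis
      using Suc by blast
  qed
qed

section \<open>Fat points and residuation\<close>

text \<open>The last argument is one more than the degree, so that 0 stands for degree -1.\<close>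

definition fat_forms :: "'a::field vec3 set \<Rightarrow> ('a vec3 \<Rightarrow> nat) \<Rightarrow> nat \<Rightarrow> ('a vec3 \<Rightarrow> 'a) set" where
  "fat_forms X \<mu> T = (case T of 0 \<Rightarrow> {\<lambda>_. 0} | Suc t \<Rightarrow> {F \<in> PF t. \<forall>p\<in>X. vord (\<mu> p) p F})"

text \<open>Multiplicities of the residual scheme, whose ideal is the quotient of the fat point
  ideal by the equation of the line.\<close>

definition residual :: "'a vec3 set \<Rightarrow> ('a vec3 \<Rightarrow> nat) \<Rightarrow> 'a vec3 \<Rightarrow> nat" where
  "residual L \<mu> = (\<lambda>p. if p \<in> L then \<mu> p - 1 else \<mu> p)"

text \<open>Twice \<open>h\<^sup>1\<close> of the ideal sheaf of the fat points in degree \<open>T - 1\<close>, that is, the dimension of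
  \<open>fat_forms X \<mu> T\<close> minus the expected one; doubled to stay clear of division.\<close>

definition h1_twice :: "'a::field vec3 set \<Rightarrow> ('a vec3 \<Rightarrow> nat) \<Rightarrow> nat \<Rightarrow> int" where
  "h1_twice X \<mu> T = 2 * int (fs.dim (fat_forms X \<mu> T)) - int T * (int T + 1)
     + (\<Sum>p\<in>X. int (\<mu> p) * (int (\<mu> p) + 1))"

lemma mem_line_of: "p \<in> line_of l \<longleftrightarrow> dot l p = 0"
  by (cases l; cases p) (simp add: line_of_def)

lemma fat_forms_subspace: "fs.subspace (fat_forms X \<mu> T)"
  unfolding fat_forms_def
  by (rule fs_subspaceI) (auto split: nat.splits intro: PF_0 PF_add PF_scale vord_zero vord_add vord_scale)

lemma fat_forms_finite_span: "fat_forms X \<mu> (Suc t) \<subseteq> fs.span (mon_val ` mon_exps t)"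
  using PF_finite_span[of t] by (auto simp: fat_forms_def)

lemma dim_fat_forms_0 [simp]: "fs.dim (fat_forms X \<mu> 0) = 0"
proof -
  have "fat_forms X \<mu> 0 \<subseteq> fs.span {}"
    by (auto simp: fat_forms_def zero_fun_def)
  from fs.dim_le_card[OF this] show ?thesis
    by simp
qed

lemma dim_forms: "fs.dim (forms t :: (_ \<Rightarrow> 'a::field) set) = card (mon_exps t)"
proof (rule fs.dim_unique)
  let ?u = "\<lambda>e e'. if e' = e then 1 else (0::'a)"
  have inj: "inj ?u"
    by (rule injI) (metis zero_neq_one)
  show "?u ` mon_exps t \<subseteq> forms t"
    by (auto simp: forms_def)
  show "card (?u ` mon_exps t) = card (mon_exps t)"
    using inj by (intro card_image) (auto intro: inj_on_subset)
  show "forms t \<subseteq> fs.span (?u ` mon_exps t)"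
  proof
    fix f :: "_ \<Rightarrow> 'a" assume f: "f \<in> forms t"
    have "f = (\<Sum>e\<in>mon_exps t. (\<lambda>x. f e * ?u e x))"
    proof
      fix x
      have "(\<Sum>e\<in>mon_exps t. (\<lambda>x. f e * ?u e x)) x = (\<Sum>e\<in>mon_exps t. if x = e then f e else 0)"
        unfolding sum_fun_apply by (intro sum.cong) auto
      also have "\<dots> = f x"
        using formsD[OF f, of x] by (subst sum.delta'[OF finite_mon_exps]) auto
      finally show "f x = (\<Sum>e\<in>mon_exps t. (\<lambda>x. f e * ?u e x)) x" ..
    qed
    also have "\<dots> \<in> fs.span (?u ` mon_exps t)"
      by (intro fs.span_sum fs.span_scale fs.span_base imageI)
    finally show "f \<in> fs.span (?u ` mon_exps t)" .
  qed
  show "fs.independent (?u ` mon_exps t)"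
  proof (rule fs.independent_if_scalars_zero)
    show "finite (?u ` mon_exps t)"
      by simp
    fix c x assume 0: "(\<Sum>x\<in>?u ` mon_exps t. (\<lambda>y. c x * x y)) = 0" and x: "x \<in> ?u ` mon_exps t"
    obtain e where e: "e \<in> mon_exps t" "x = ?u e"
      using x by blast
    have "0 = (\<Sum>e'\<in>mon_exps t. (\<lambda>y. c (?u e') * ?u e' y)) e"
      using 0 inj by (subst (asm) sum.reindex) (auto simp: zero_fun_def o_def intro: inj_on_subset)
    also have "\<dots> = (\<Sum>e'\<in>mon_exps t. if e = e' then c (?u e') else 0)"
      unfolding sum_fun_apply by (intro sum.cong) auto
    also have "\<dots> = c x"
      using e by (subst sum.delta'[OF finite_mon_exps]) auto
    finally show "c x = 0" ..
  qed
qed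

lemma eval_form_inj_on: "inj_on (eval_form t) (forms t :: (_ \<Rightarrow> 'a::alg_closed_field) set)"
  by (rule inj_onI) (rule eval_form_inj)

lemma forms_subspace: "fs.subspace (forms t)"
  by (rule fs_subspaceI) (auto simp: forms_def)

lemma dim_PF: "fs.dim (PF t :: ('a::alg_closed_field vec3 \<Rightarrow> 'a) set) = card (mon_exps t)"
  unfolding PF_eq dim_forms[of t, where 'a = 'a, symmetric]
  by (rule fs_dim_image_eq[OF forms_subspace eval_form_add eval_form_scale eval_form_inj_on])

lemma kdim_forms: "kdim (forms t :: (_ \<Rightarrow> 'a::field) set) = card (mon_exps t)"
  unfolding kdim_def by (rule dim_forms)

lemma kdim_fat_ideal:
  fixes X :: "'a::alg_closed_field vec3 set"
  shows "kdim (fat_ideal_deg m X t) = fs.dim (fat_forms X (\<lambda>_. m) (Suc t))"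
proof -
  have eq: "fat_ideal_deg m X t = {f \<in> forms t. \<forall>p\<in>X. vord m p (eval_form t f)}"
    by (simp add: fat_ideal_deg_def vord_iff_in_fat_ideal)
  have img: "eval_form t ` fat_ideal_deg m X t = fat_forms X (\<lambda>_. m) (Suc t)"
    unfolding eq fat_forms_def PF_eq by auto
  have "fs.subspace (fat_ideal_deg m X t)"
  proof (rule fs_subspaceI)
    show "(\<lambda>x. 0) \<in> fat_ideal_deg m X t"
    proof -
      have "eval_form t (\<lambda>x. 0 :: 'a) = (\<lambda>_. 0)"
        by (simp add: eval_form_def fun_eq_iff)
      then show ?thesis
        unfolding eq by (simp add: forms_def vord_zero)
    qed
    fix f g assume fg: "f \<in> fat_ideal_deg m X t" "g \<in> fat_ideal_deg m X t"
    have "eval_form t (\<lambda>x. f x + g x) = (\<lambda>v. eval_form t f v + eval_form t g v)"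
      using eval_form_add[of t f g] by (simp add: plus_fun_def)
    then show "(\<lambda>x. f x + g x) \<in> fat_ideal_deg m X t"
      using fg unfolding eq by (auto simp: forms_def intro: vord_add)
  next
    fix c f assume "f \<in> fat_ideal_deg m X t"
    then show "(\<lambda>x. c * f x) \<in> fat_ideal_deg m X t"
      unfolding eq by (auto simp: forms_def eval_form_scale intro: vord_scale)
  qed
  moreover have "inj_on (eval_form t) (fat_ideal_deg m X t)"
    using eval_form_inj_on by (rule inj_on_subset) (auto simp: eq)
  ultimately have "fs.dim (eval_form t ` fat_ideal_deg m X t) = fs.dim (fat_ideal_deg m X t)"
    by (intro fs_dim_image_eq eval_form_add eval_form_scale)
  then show ?thesis
    unfolding img kdim_def ..
qed

text \<open>Recovers coefficients from a polynomial function, which makes them linear functionals on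
  \<open>PF t\<close>.\<close>

definition form_of :: "nat \<Rightarrow> ('a::field vec3 \<Rightarrow> 'a) \<Rightarrow> nat \<times> nat \<times> nat \<Rightarrow> 'a" where
  "form_of t F = inv_into (forms t) (eval_form t) F"

lemma form_of:
  assumes "F \<in> PF t"
  shows "form_of t F \<in> forms t" "eval_form t (form_of t F) = F"
  using assms unfolding form_of_def PF_eq by (rule inv_into_into, rule f_inv_into_f)

lemma form_of_eval:
  fixes f :: "nat \<times> nat \<times> nat \<Rightarrow> 'a::alg_closed_field"
  shows "f \<in> forms t \<Longrightarrow> form_of t (eval_form t f) = f"
  unfolding form_of_def by (rule inv_into_f_f[OF eval_form_inj_on])

lemma form_of_add:
  fixes F G :: "'a::alg_closed_field vec3 \<Rightarrow> 'a"
  assumes "F \<in> PF t" "G \<in> PF t"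
  shows "form_of t (F + G) = form_of t F + form_of t G"
proof -
  have "form_of t F + form_of t G \<in> forms t"
    by (intro fs.subspace_add[OF forms_subspace] form_of assms)
  then show ?thesis
    using form_of_eval[of "form_of t F + form_of t G" t] by (simp add: eval_form_add form_of assms)
qed

lemma form_of_scale:
  fixes F :: "'a::alg_closed_field vec3 \<Rightarrow> 'a"
  assumes "F \<in> PF t"
  shows "form_of t (fscale c F) = fscale c (form_of t F)"
proof -
  have "fscale c (form_of t F) \<in> forms t"
    by (intro fs.subspace_scale[OF forms_subspace] form_of assms)
  then show ?thesis
    using form_of_eval[of "fscale c (form_of t F)" t] by (simp add: eval_form_scale form_of assms)
qed

lemma card_triangle: "2 * card {(b, c). b + c < (m::nat)} = m * (m + 1)"
proof -
  have "{(b, c). b + c < m} = (SIGMA b:{..<m}. {..<m - b})"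
    by auto
  then have "card {(b, c). b + c < m} = (\<Sum>b<m. m - b)"
    by simp
  also have "\<dots> = (\<Sum>b<m. Suc b)"
    by (rule sum.reindex_bij_witness[of _ "\<lambda>b. m - Suc b" "\<lambda>b. m - Suc b"]) auto
  also have "2 * \<dots> = m * (m + 1)"
    by (induction m) auto
  finally show ?thesis .
qed

lemma finite_triangle: "finite {(b, c). b + c < (m::nat)}"
  by (rule finite_subset[of _ "{..<m} \<times> {..<m}"]) auto

text \<open>Vanishing to order \<mu> at a point is implied by \<mu> (\<mu> + 1) / 2 linear
  conditions, namely the coefficients with b + c < \<mu> in a frame at that point. So the dimension
  is never below the expected one.\<close>

lemma h1_nonneg:
  fixes X :: "'a::alg_closed_field vec3 set"
  assumes "finite X" "(0, 0, 0) \<notin> X"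
  shows "0 \<le> h1_twice X \<mu> T"
proof (cases T)
  case 0
  then show ?thesis
    by (auto simp: h1_twice_def intro!: sum_nonneg)
next
  case (Suc t)
  have "\<exists>q r. p \<in> X \<longrightarrow> det3 p q r \<noteq> 0" for p
    using frame_at_point[of p] assms(2) by metis
  then obtain Q R where QR: "\<And>p. p \<in> X \<Longrightarrow> det3 p (Q p) (R p) \<noteq> 0"
    by metis
  define fr where "fr p F = (\<lambda>v. F (frame p (Q p) (R p) v))" for p and F :: "'a vec3 \<Rightarrow> 'a"
  \<comment> \<open>The coefficient of x^(t - b - c) y^b z^c in the frame at \<open>p\<close>. For b
    + c > t the exponents do not add up to t and the functional is 0 on \<open>PF t\<close>, so the
    count stays valid in small degrees.\<close>
  define \<phi> where "\<phi> = (\<lambda>(p, b, c) F. form_of t (fr p F) (t - b - c, b, c))"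
  define I where "I = (SIGMA p:X. {(b, c). b + c < \<mu> p})"
  have fr: "fr p F \<in> PF t" if "F \<in> PF t" for p F
    unfolding fr_def using that by (rule PF_frame)
  have "finite I"
    unfolding I_def using assms(1) finite_triangle by blast
  have dim: "fs.dim (PF t :: ('a vec3 \<Rightarrow> 'a) set) \<le> fs.dim {F \<in> PF t. \<forall>i\<in>I. \<phi> i F = 0} + card I"
  proof (rule conjunct1[OF fs_dim_kernels[OF \<open>finite I\<close> PF_subspace PF_finite_span]])
    show "finite (mon_val ` mon_exps t)"
      by simp
    show "\<phi> i (F + G) = \<phi> i F + \<phi> i G" if "i \<in> I" "F \<in> PF t" "G \<in> PF t" for i F G
    proof -
      have "fr p (F + G) = fr p F + fr p G" for p
        by (simp add: fr_def fun_eq_iff)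
      then show ?thesis
        using that by (simp add: \<phi>_def form_of_add fr split: prod.splits)
    qed
    show "\<phi> i (fscale c F) = c * \<phi> i F" if "i \<in> I" "F \<in> PF t" for i c F
    proof -
      have "fr p (fscale c F) = fscale c (fr p F)" for p
        by (simp add: fr_def fun_eq_iff)
      then show ?thesis
        using that by (simp add: \<phi>_def form_of_scale fr split: prod.splits)
    qed
  qed
  have "{F \<in> PF t. \<forall>i\<in>I. \<phi> i F = 0} \<subseteq> fat_forms X \<mu> T"
  proof
    fix F assume F: "F \<in> {F \<in> PF t. \<forall>i\<in>I. \<phi> i F = 0}"
    have "vord (\<mu> p) p F" if p: "p \<in> X" for p
    proof -
      obtain p' q' r' where inv: "\<And>v. frame p (Q p) (R p) (frame p' q' r' v) = v"
          "\<And>v. frame p' q' r' (frame p (Q p) (R p) v) = v"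
        using QR[OF p] by (rule frame_inverse) (rule that)
      have frF: "fr p F = eval_form t (form_of t (fr p F))"
        using F by (simp add: form_of fr)
      have "form_of t (fr p F) (a, b, c) = 0" if "a + b + c = t" "b + c < \<mu> p" for a b c
      proof -
        have "(p, b, c) \<in> I"
          using p that by (simp add: I_def)
        then have "\<phi> (p, b, c) F = 0"
          using F by blast
        moreover have "a = t - b - c"
          using that by simp
        ultimately show ?thesis
          by (simp add: \<phi>_def)
      qed
      then have "vord (\<mu> p) (1, 0, 0) (eval_form t (form_of t (fr p F)))"
        unfolding vord_e0_iff by blast
      then have "vord (\<mu> p) (1, 0, 0) (fr p F)"
        by (simp only: frF[symmetric])
      then show ?thesis
        using vord_frame_inverse[OF inv, of "\<mu> p" "(1, 0, 0)" F] by (simp add: fr_def frame_e0)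
    qed
    then show "F \<in> fat_forms X \<mu> T"
      using F by (simp add: fat_forms_def Suc)
  qed
  then have "fs.dim {F \<in> PF t. \<forall>i\<in>I. \<phi> i F = 0} \<le> fs.dim (fat_forms X \<mu> T)"
    unfolding Suc by (intro fs_dim_mono[OF _ fat_forms_finite_span]) (auto intro: fs.span_base)
  then have "card (mon_exps t) \<le> fs.dim (fat_forms X \<mu> T) + card I"
    using dim by (simp add: dim_PF)
  then have "(t + 1) * (t + 2) \<le> 2 * fs.dim (fat_forms X \<mu> T) + 2 * card I"
    using card_mon_exps[of t] by linarith
  moreover have "2 * card I = (\<Sum>p\<in>X. \<mu> p * (\<mu> p + 1))"
  proof -
    have "card I = (\<Sum>p\<in>X. card {(b, c). b + c < \<mu> p})"
      unfolding I_def using assms(1) finite_triangle by (intro card_SigmaI) auto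
    then show ?thesis
      by (simp only: sum_distrib_left card_triangle)
  qed
  ultimately have "(t + 1) * (t + 2) \<le> 2 * fs.dim (fat_forms X \<mu> T) + (\<Sum>p\<in>X. \<mu> p * (\<mu> p + 1))"
    by simp
  then have "int ((t + 1) * (t + 2)) \<le> int (2 * fs.dim (fat_forms X \<mu> T) + (\<Sum>p\<in>X. \<mu> p * (\<mu> p + 1)))"
    by (simp only: of_nat_le_iff)
  then show ?thesis
    by (simp add: h1_twice_def Suc algebra_simps)
qed

text \<open>The end point of a complete sequence of residuals: no conditions are left, so all forms
  qualify and the dimension is T (T + 1) / 2.\<close>

lemma h1_empty:
  fixes X :: "'a::alg_closed_field vec3 set"
  assumes "\<And>p. p \<in> X \<Longrightarrow> \<mu> p = 0"
  shows "h1_twice X \<mu> T = 0"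
proof (cases T)
  case 0
  then show ?thesis
    using assms by (simp add: h1_twice_def)
next
  case (Suc t)
  have "fat_forms X \<mu> T = PF t"
    using assms by (auto simp: fat_forms_def Suc intro: vord_0)
  then have "2 * fs.dim (fat_forms X \<mu> T) = (t + 1) * (t + 2)"
    by (simp add: dim_PF card_mon_exps)
  then have "2 * int (fs.dim (fat_forms X \<mu> T)) = (int t + 1) * (int t + 2)"
    by (metis (mono_tags, lifting) of_nat_1 of_nat_add of_nat_mult of_nat_numeral)
  then show ?thesis
    using assms by (simp add: h1_twice_def Suc algebra_simps)
qed

section \<open>Restriction of forms to a line\<close>

lemma proportional_iff: "proportional u v \<longleftrightarrow> (\<exists>c. c \<noteq> 0 \<and> v = vsc c u)"
  by (cases u; cases v) (auto simp: proportional_def)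

lemma vsc_cancel: "vsc a x = vsc b x \<Longrightarrow> x \<noteq> (0, 0, 0) \<Longrightarrow> a = b"
  by (cases x) auto

lemma vsc_vsc: "vsc a (vsc b x) = vsc (a * b) x"
  by (cases x) (simp add: mult.assoc)

lemma cross_along:
  "cross (a, b, c) (along (x, y, z) (a, b, c) \<tau>) = cross (a, b, c) (x, y, z)"
  "cross (vsc k (along (x, y, z) (a, b, c) \<tau>)) (a, b, c) = vsc (- k) (cross (a, b, c) (x, y, z))"
  "cross (x, y, z) (vsc k (along (x, y, z) (a, b, c) \<tau>)) = vsc (- (k * \<tau>)) (cross (a, b, c) (x, y, z))"
  by (simp_all only: cross.simps along.simps vsc.simps prod.inject; intro conjI; algebra)+

text \<open>The parametrization u + s w misses the point \<open>w\<close> of the line. Replacing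
  \<open>w\<close> by w + \<tau> u moves the missing point; each point of \<open>X\<close> excludes
  at most one \<tau>, and the field is infinite.\<close>

lemma line_basis_avoiding:
  fixes X :: "'a::alg_closed_field vec3 set"
  assumes "finite X" "(0, 0, 0) \<notin> X" "l \<noteq> (0, 0, 0)"
  obtains u w where "cross u w = l" "\<And>p k. p \<in> X \<Longrightarrow> p \<noteq> vsc k w"
proof -
  obtain u w where uw: "cross u w = l"
    using line_basis[OF assms(3)] .
  have eq1: "cross u (along w u \<tau>) = cross u w" for \<tau>
    by (cases u; cases w) (simp only: cross_along)
  have eq2: "cross (vsc k (along w u \<tau>)) u = vsc (- k) (cross u w)" for k \<tau>
    by (cases u; cases w) (simp only: cross_along)
  have eq3: "cross w (vsc k (along w u \<tau>)) = vsc (- (k * \<tau>)) (cross u w)" for k \<tau>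
    by (cases u; cases w) (simp only: cross_along)
  \<comment> \<open>The cross products of p = k (w + \<tau> u) with \<open>u\<close> and
    \<open>w\<close> are multiples of \<open>l\<close> with factors -k and -k \<tau>, so
    \<open>p\<close> determines k and \<tau>.\<close>
  have unique: "\<tau> = \<tau>'" if "p \<in> X" "p = vsc k (along w u \<tau>)" "p = vsc k' (along w u \<tau>')" for p k k' \<tau> \<tau>'
  proof -
    have "vsc (- k) l = vsc (- k') l" "vsc (- (k * \<tau>)) l = vsc (- (k' * \<tau>')) l"
      using eq2[of k \<tau>] eq2[of k' \<tau>'] eq3[of k \<tau>] eq3[of k' \<tau>'] that uw by simp_all
    then have "k = k'" "k * \<tau> = k' * \<tau>'"
      using vsc_cancel[OF _ assms(3)] by (metis neg_equal_iff_equal)+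
    moreover have "k \<noteq> 0"
      using that(1,2) assms(2) by (cases "along w u \<tau>") auto
    ultimately show ?thesis
      by simp
  qed
  have "finite {\<tau>. \<exists>k. p = vsc k (along w u \<tau>)}" if p: "p \<in> X" for p
  proof (cases "\<exists>\<tau> k. p = vsc k (along w u \<tau>)")
    case True
    then obtain \<tau> k where "p = vsc k (along w u \<tau>)"
      by blast
    then have "{\<tau>. \<exists>k. p = vsc k (along w u \<tau>)} \<subseteq> {\<tau>}"
      using unique[OF p] by blast
    then show ?thesis
      by (rule finite_subset) simp
  qed simp
  then have "finite (\<Union>p\<in>X. {\<tau>. \<exists>k. p = vsc k (along w u \<tau>)})"
    using assms(1) by blast
  then obtain \<tau> where "\<tau> \<notin> (\<Union>p\<in>X. {\<tau>. \<exists>k. p = vsc k (along w u \<tau>)})"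
    using infinite_UNIV_alg_closed ex_new_if_finite by blast
  then show thesis
    using that[of u "along w u \<tau>"] eq1 uw by auto
qed

lemma line_point_param:
  assumes uw: "cross u w = l" and l: "l \<noteq> (0, 0, 0)" and p: "dot l p = 0" and pw: "\<And>k. p \<noteq> vsc k w"
  obtains c s where "c \<noteq> 0" "p = vsc c (along u w s)"
proof -
  obtain q where q: "dot l q = 1"
    using dot_eq_1[OF l] .
  have "det3 q u w \<noteq> 0"
    using q by (simp add: uw dot_commute[of q])
  then obtain p' q' r' where inv: "\<And>v. frame q u w (frame p' q' r' v) = v" "\<And>v. frame p' q' r' (frame q u w v) = v"
    by (rule frame_inverse) (rule that)
  obtain x y z where "frame p' q' r' p = (x, y, z)"
    by (metis prod_cases3)
  then have pxyz: "p = frame q u w (x, y, z)"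
    by (metis inv(1))
  have luw: "dot l u = 0" "dot l w = 0"
    using uw dot_cross_self by metis+
  have "x = 0"
    using p unfolding pxyz dot_frame by (simp add: luw q)
  have "y \<noteq> 0"
  proof
    assume "y = 0"
    then have "p = vsc z w"
      unfolding pxyz \<open>x = 0\<close> by (cases q; cases u; cases w) simp
    then show False
      using pw by blast
  qed
  moreover have "p = vsc y (along u w (z / y))"
    unfolding pxyz \<open>x = 0\<close> using \<open>y \<noteq> 0\<close> by (cases q; cases u; cases w) (simp add: algebra_simps)
  ultimately show thesis
    by (rule that)
qed

text \<open>Only multiples v = k w escape the parametrization. For s nonzero, v + s u is s times a
  parametrized point, so the missing value at s = 0 follows by extension.\<close>

lemma vanish_on_line:
  fixes F :: "'a::alg_closed_field vec3 \<Rightarrow> 'a"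
  assumes F: "F \<in> PF t" and zero: "\<And>s. F (along u w s) = 0"
    and uw: "cross u w = l" and l: "l \<noteq> (0, 0, 0)" and v: "dot l v = 0"
  shows "F v = 0"
proof (cases "\<exists>k. v = vsc k w")
  case False
  then obtain c s where "v = vsc c (along u w s)"
    using line_point_param[OF uw l v] by metis
  then show ?thesis
    by (simp add: PF_homogeneous[OF F] zero)
next
  case True
  then obtain k where k: "v = vsc k w"
    by blast
  have "F (along v u s) = 0" if "s \<noteq> 0" for s
  proof -
    have "along v u s = vsc s (along u w (k / s))"
      unfolding k using that by (cases u; cases w) (simp add: algebra_simps)
    then show ?thesis
      by (simp add: PF_homogeneous[OF F] zero)
  qed
  then show ?thesis
    using PF_vanish_extend[OF F, of 0 v u 0] by (simp add: along_0)
qed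

definition line_poly :: "'a::alg_closed_field vec3 \<Rightarrow> 'a vec3 \<Rightarrow> ('a vec3 \<Rightarrow> 'a) \<Rightarrow> 'a poly" where
  "line_poly u w F = (THE q. \<forall>s. F (along u w s) = poly q s)"

lemma line_poly_eqI:
  assumes "\<And>s. F (along u w s) = poly q s"
  shows "line_poly u w F = q"
  unfolding line_poly_def using assms by (intro the_equality) (auto intro: poly_eqI_fun)

lemma line_poly:
  assumes "F \<in> PF t"
  shows "poly (line_poly u w F) s = F (along u w s)" "degree (line_poly u w F) \<le> t"
proof -
  obtain f where f: "F = eval_form t f"
    using assms by (auto simp: PF_def)
  define q where "q = (\<Sum>g\<in>box t. monom (hasse t f u g * mon_val g w) (esum g))"
  have "F (along u w s) = poly q s" for s
    by (simp add: f q_def taylor poly_sum poly_monom)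
  then have eq: "line_poly u w F = q" and "poly q s = F (along u w s)"
    by (auto intro: line_poly_eqI)
  then show "poly (line_poly u w F) s = F (along u w s)"
    by simp
  have "degree (monom (hasse t f u g * mon_val g w) (esum g)) \<le> t" for g
    using hasse_eq_0_outside[of t g f u] by (cases "t < esum g") (auto intro: order_trans[OF degree_monom_le])
  then show "degree (line_poly u w F) \<le> t"
    unfolding eq q_def by (intro degree_sum_le) auto
qed

text \<open>Going from \<open>p\<close> in direction c w stays on the parametrized line with
  parameter a + \<sigma>, up to the factor c^t; the substitution \<sigma> = x - a turns \<sigma>^m
  into (x - a)^m.\<close>

lemma line_poly_dvd:
  assumes F: "F \<in> PF t" and p: "p = vsc c (along u w a)" "c \<noteq> 0" and ord: "vord m p F"
  shows "[:- a, 1:] ^ m dvd line_poly u w F"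
proof -
  obtain q where q: "\<And>\<sigma>. F (along p (vsc c w) \<sigma>) = \<sigma> ^ m * poly q \<sigma>"
    using ord unfolding vord_def by metis
  have al: "along p (vsc c w) \<sigma> = vsc c (along u w (a + \<sigma>))" for \<sigma>
    unfolding p by (cases u; cases w) (simp add: algebra_simps)
  have "smult (c ^ t) (line_poly u w F) = [:- a, 1:] ^ m * pcompose q [:- a, 1:]"
  proof (rule poly_eqI_fun)
    fix x
    show "poly (smult (c ^ t) (line_poly u w F)) x = poly ([:- a, 1:] ^ m * pcompose q [:- a, 1:]) x"
      using q[of "x - a"] unfolding al by (simp add: line_poly[OF F] PF_homogeneous[OF F] poly_pcompose)
  qed
  then have "[:- a, 1:] ^ m dvd smult (c ^ t) (line_poly u w F)"
    by simp
  then show ?thesis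
    using p(2) by (simp add: dvd_smult_iff)
qed

text \<open>The factors have distinct roots, so the order at the new root is not affected by the
  product already split off.\<close>

lemma prod_linear_powers_dvd:
  fixes s :: "'b \<Rightarrow> 'a::field"
  assumes "finite S" "inj_on s S" "\<And>p. p \<in> S \<Longrightarrow> [:- s p, 1:] ^ \<mu> p dvd g"
  shows "(\<Prod>p\<in>S. [:- s p, 1:] ^ \<mu> p) dvd g"
  using assms
proof (induction S)
  case (insert p S)
  let ?G = "\<Prod>p\<in>S. [:- s p, 1:] ^ \<mu> p"
  have "?G dvd g"
    using insert.prems by (intro insert.IH) (auto simp: inj_on_insert)
  then obtain h where h: "g = ?G * h"
    by (rule dvdE)
  have "s p \<noteq> s q" if "q \<in> S" for q
    using that insert.hyps insert.prems(1) by (auto simp: inj_on_def)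
  then have "poly ?G (s p) \<noteq> 0"
    using insert.hyps(1) by (simp add: poly_prod)
  then have ord: "order (s p) ?G = 0" "?G \<noteq> 0"
    by (auto simp: order_root)
  have "[:- s p, 1:] ^ \<mu> p dvd h"
  proof (cases "h = 0")
    case False
    then have "order (s p) g = order (s p) h" "g \<noteq> 0"
      using ord by (simp_all add: h order_mult)
    then show ?thesis
      using insert.prems(2)[of p] by (simp add: order_divides)
  qed simp
  then show ?case
    unfolding prod.insert[OF insert.hyps] h by (subst mult.commute) (intro mult_dvd_mono dvd_refl)
qed simp

text \<open>The degree of the intersection of the fat point scheme with the line.\<close>

definition line_degree :: "'a set \<Rightarrow> 'a set \<Rightarrow> ('a \<Rightarrow> nat) \<Rightarrow> nat" where
  "line_degree X L \<mu> = (\<Sum>p\<in>X \<inter> L. \<mu> p)"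

lemma mult_line_fat_forms:
  fixes F :: "'a::alg_closed_field vec3 \<Rightarrow> 'a"
  assumes "F \<in> fat_forms X (residual (line_of l) \<mu>) t"
  shows "(\<lambda>v. dot l v * F v) \<in> fat_forms X \<mu> (Suc t)"
proof (cases t)
  case 0
  then show ?thesis
    using assms by (simp add: fat_forms_def PF_0 vord_zero)
next
  case (Suc t')
  then have F: "F \<in> PF t'" "\<And>p. p \<in> X \<Longrightarrow> vord (residual (line_of l) \<mu> p) p F"
    using assms by (auto simp: fat_forms_def)
  have lF: "(\<lambda>v. dot l v * F v) \<in> PF t"
    using PF_mult[OF PF_dot F(1)] by (simp add: Suc)
  have "vord (\<mu> p) p (\<lambda>v. dot l v * F v)" if "p \<in> X" for p
  proof (cases "\<mu> p = 0")
    case True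
    then show ?thesis
      using vord_0[OF lF] by simp
  next
    case False
    show ?thesis
    proof (cases "dot l p = 0")
      case True
      then show ?thesis
        using vord_mult[OF vord_dot_1[OF True] F(2)[OF that]] False
        by (simp add: residual_def mem_line_of)
    next
      case False
      then show ?thesis
        using vord_mult[OF vord_dot F(2)[OF that]] by (simp add: residual_def mem_line_of)
    qed
  qed
  then show ?thesis
    using lF by (simp add: fat_forms_def)
qed

lemma divide_line_fat_forms:
  fixes F :: "'a::alg_closed_field vec3 \<Rightarrow> 'a"
  assumes "(0, 0, 0) \<notin> X" "l \<noteq> (0, 0, 0)" "F \<in> fat_forms X \<mu> (Suc t)" "\<And>v. dot l v = 0 \<Longrightarrow> F v = 0"
  shows "\<exists>G \<in> fat_forms X (residual (line_of l) \<mu>) t. F = (\<lambda>v. dot l v * G v)"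
proof -
  have F: "F \<in> PF t" "\<And>p. p \<in> X \<Longrightarrow> vord (\<mu> p) p F"
    using assms(3) by (auto simp: fat_forms_def)
  from PF_divide[OF F(1) assms(2,4)] show ?thesis
  proof
    assume "F = (\<lambda>v. 0)"
    then show ?thesis
      using fs.subspace_0[OF fat_forms_subspace] by (intro bexI[of _ 0]) (auto simp: zero_fun_def)
  next
    assume "\<exists>t' F'. t = Suc t' \<and> F' \<in> PF t' \<and> F = (\<lambda>v. dot l v * F' v)"
    then obtain t' G where G: "t = Suc t'" "G \<in> PF t'" "F = (\<lambda>v. dot l v * G v)"
      by blast
    have "vord (residual (line_of l) \<mu> p) p G" if p: "p \<in> X" for p
    proof (cases "dot l p = 0")
      case True
      show ?thesis
      proof (cases "\<mu> p")
        case 0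
        then show ?thesis
          using vord_0[OF G(2)] by (simp add: residual_def)
      next
        case (Suc m)
        have "p \<noteq> (0, 0, 0)"
          using assms(1) p by metis
        then have "vord m p G"
          using vord_cancel_through[OF G(2) _ True assms(2)] F(2)[OF p] Suc G(3) by simp
        then show ?thesis
          using True Suc by (simp add: residual_def mem_line_of)
      qed
    next
      case False
      then show ?thesis
        using vord_cancel_off[OF G(2) False] F(2)[OF p] G(3) by (simp add: residual_def mem_line_of)
    qed
    then have "G \<in> fat_forms X (residual (line_of l) \<mu>) t"
      using G by (simp add: fat_forms_def)
    then show ?thesis
      using G(3) by blast
  qed
qed

text \<open>Two products with \<open>dot l\<close> can be cancelled pointwise only off the line;
  \<open>PF_vanish_off_line\<close> supplies the values on it.\<close>

lemma dim_mult_line: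
  fixes X :: "'a::alg_closed_field vec3 set"
  assumes "l \<noteq> (0, 0, 0)"
  shows "fs.dim ((\<lambda>F v. dot l v * F v) ` fat_forms X \<mu> t) = fs.dim (fat_forms X \<mu> t)"
proof (rule fs_dim_image_eq[OF fat_forms_subspace])
  show "inj_on (\<lambda>F v. dot l v * F v) (fat_forms X \<mu> t)"
  proof (rule inj_onI)
    fix F G assume FG: "F \<in> fat_forms X \<mu> t" "G \<in> fat_forms X \<mu> t" "(\<lambda>v. dot l v * F v) = (\<lambda>v. dot l v * G v)"
    then have D: "F - G \<in> fat_forms X \<mu> t"
      using fs.subspace_diff[OF fat_forms_subspace] by blast
    have D0: "(F - G) v = 0" if "dot l v \<noteq> 0" for v
      using fun_cong[OF FG(3), of v] that by (simp add: fun_diff_def)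
    have "(F - G) v = 0" for v
    proof (cases t)
      case 0
      then show ?thesis
        using D by (simp add: fat_forms_def)
    next
      case (Suc t')
      then have "F - G \<in> PF t'"
        using D by (simp add: fat_forms_def)
      from PF_vanish_off_line[OF this assms D0] show ?thesis .
    qed
    then show "F = G"
      by (simp add: fun_eq_iff fun_diff_def)
  qed
qed (auto simp: fun_eq_iff algebra_simps)

lemma dim_residual_le:
  fixes X :: "'a::alg_closed_field vec3 set"
  assumes "l \<noteq> (0, 0, 0)"
  shows "fs.dim (fat_forms X (residual (line_of l) \<mu>) (T - 1)) \<le> fs.dim (fat_forms X \<mu> T)"
proof (cases T)
  case (Suc t)
  have "fs.dim (fat_forms X (residual (line_of l) \<mu>) t) =
      fs.dim ((\<lambda>F v. dot l v * F v) ` fat_forms X (residual (line_of l) \<mu>) t)"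
    using dim_mult_line[OF assms] by metis
  also have "\<dots> \<le> fs.dim (fat_forms X \<mu> (Suc t))"
    by (intro fs_dim_mono[OF _ fat_forms_finite_span]) (auto intro!: fs.span_base mult_line_fat_forms)
  finally show ?thesis
    by (simp add: Suc)
qed simp

text \<open>Restriction to the line has as kernel the multiples of its equation, that is, the
  residual space. Its image consists of polynomials of degree at most T - 1 divisible by a fixed one
  of degree \<open>line_degree\<close>.\<close>

lemma dim_le_residual:
  fixes X :: "'a::alg_closed_field vec3 set"
  assumes X: "proj_point_set X" and l: "l \<noteq> (0, 0, 0)"
  shows "fs.dim (fat_forms X \<mu> T) \<le>
    fs.dim (fat_forms X (residual (line_of l) \<mu>) (T - 1)) + (T - line_degree X (line_of l) \<mu>)"
proof (cases T)
  case (Suc t)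
  have fin: "finite X" and X0: "(0, 0, 0) \<notin> X"
    and distinct: "\<And>p q. p \<in> X \<Longrightarrow> q \<in> X \<Longrightarrow> proportional p q \<Longrightarrow> p = q"
    using X by (auto simp: proj_point_set_def)
  obtain u w where uw: "cross u w = l" and av: "\<And>p k. p \<in> X \<Longrightarrow> p \<noteq> vsc k w"
    using line_basis_avoiding[OF fin X0 l] by metis
  define S where "S = X \<inter> line_of l"
  have "\<exists>c s. c \<noteq> 0 \<and> p = vsc c (along u w s)" if "p \<in> S" for p
    using line_point_param[OF uw l, of p] that av unfolding S_def Int_iff mem_line_of by metis
  then obtain c s where cs: "\<And>p. p \<in> S \<Longrightarrow> c p \<noteq> 0" "\<And>p. p \<in> S \<Longrightarrow> p = vsc (c p) (along u w (s p))"
    by metis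
  have inj: "inj_on s S"
  proof (rule inj_onI)
    fix p q assume pq: "p \<in> S" "q \<in> S" "s p = s q"
    have "q = vsc (c q / c p) (vsc (c p) (along u w (s p)))"
      using cs(1)[OF pq(1)] cs(2)[OF pq(2)] pq(3) by (simp add: vsc_vsc)
    also have "\<dots> = vsc (c q / c p) p"
      using cs(2)[OF pq(1)] by simp
    finally have "proportional p q"
      using cs(1) pq unfolding proportional_iff by (intro exI[of _ "c q / c p"]) auto
    then show "p = q"
      using distinct pq by (auto simp: S_def)
  qed
  define G where "G = (\<Prod>p\<in>S. [:- s p, 1:] ^ \<mu> p)"
  define D where "D = line_degree X (line_of l) \<mu>"
  have "degree G = (\<Sum>p\<in>S. degree ([:- s p, 1:] ^ \<mu> p))"
    unfolding G_def by (rule degree_prod_eq_sum_degree) simp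
  then have degG: "degree G = D"
    by (simp add: D_def line_degree_def S_def degree_power_eq)
  have G0: "G \<noteq> 0"
    unfolding G_def using fin by (simp add: S_def)
  let ?J = "fat_forms X \<mu> T"
  have JPF: "F \<in> PF t" if "F \<in> ?J" for F
    using that by (simp add: fat_forms_def Suc)
  have Gdvd: "G dvd line_poly u w F" if "F \<in> ?J" for F
    unfolding G_def
  proof (rule prod_linear_powers_dvd[OF _ inj])
    show "finite S"
      using fin by (simp add: S_def)
    show "[:- s p, 1:] ^ \<mu> p dvd line_poly u w F" if "p \<in> S" for p
    proof (rule line_poly_dvd[OF JPF[OF \<open>F \<in> ?J\<close>] cs(2)[OF that] cs(1)[OF that]])
      show "vord (\<mu> p) p F"
        using \<open>F \<in> ?J\<close> that by (simp add: fat_forms_def Suc S_def)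
    qed
  qed
  \<comment> \<open>The quotient by \<open>G\<close> has degree below T - D, so T - D coefficients
    decide whether the restriction is zero. If D >= T the truncated difference is 0: the restriction
    vanishes for degree reasons.\<close>
  define \<phi> where "\<phi> = (\<lambda>i F. coeff (line_poly u w F div G) i)"
  let ?K = "{F \<in> ?J. \<forall>i\<in>{..<T - D}. \<phi> i F = 0}"
  have "fs.dim ?J \<le> fs.dim ?K + card {..<T - D}"
  proof (rule conjunct1[OF fs_dim_kernels[OF finite_lessThan fat_forms_subspace]])
    show "?J \<subseteq> fs.span (mon_val ` mon_exps t)"
      unfolding Suc by (rule fat_forms_finite_span)
    show "finite (mon_val ` mon_exps t)"
      by simp
    show "\<phi> i (F1 + F2) = \<phi> i F1 + \<phi> i F2" if "F1 \<in> ?J" "F2 \<in> ?J" for i F1 F2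
    proof -
      have "line_poly u w (F1 + F2) = line_poly u w F1 + line_poly u w F2"
        using that by (intro line_poly_eqI) (simp add: line_poly[OF JPF])
      then show ?thesis
        by (simp add: \<phi>_def poly_div_add_left)
    qed
    show "\<phi> i (fscale k F) = k * \<phi> i F" if "F \<in> ?J" for i k F
    proof -
      have "line_poly u w (fscale k F) = smult k (line_poly u w F)"
        using that by (intro line_poly_eqI) (simp add: line_poly[OF JPF])
      then show ?thesis
        by (simp add: \<phi>_def div_smult_left)
    qed
  qed
  moreover have "?K \<subseteq> (\<lambda>F v. dot l v * F v) ` fat_forms X (residual (line_of l) \<mu>) t"
  proof
    fix F assume F: "F \<in> ?K"
    then have FJ: "F \<in> ?J" and \<phi>: "\<And>i. i < T - D \<Longrightarrow> coeff (line_poly u w F div G) i = 0"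
      by (auto simp: \<phi>_def)
    obtain h where h: "line_poly u w F = G * h"
      using Gdvd[OF FJ] by (rule dvdE)
    have "h = 0"
    proof (rule ccontr)
      assume "h \<noteq> 0"
      then have "D + degree h \<le> t"
        using line_poly(2)[OF JPF[OF FJ], of u w] G0 by (simp add: h degree_mult_eq degG)
      then have "coeff h (degree h) = 0"
        using \<phi>[of "degree h"] G0 by (simp add: h Suc)
      then show False
        using \<open>h \<noteq> 0\<close> by simp
    qed
    then have "F (along u w x) = 0" for x
      using line_poly(1)[OF JPF[OF FJ], of u w x] h by simp
    then have "F v = 0" if "dot l v = 0" for v
      using vanish_on_line[OF JPF[OF FJ] _ uw l that] by blast
    from divide_line_fat_forms[OF X0 l FJ[unfolded Suc] this]
    show "F \<in> (\<lambda>F v. dot l v * F v) ` fat_forms X (residual (line_of l) \<mu>) t"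
      unfolding Suc by blast
  qed
  then have "fs.dim ?K \<le> fs.dim ((\<lambda>F v. dot l v * F v) ` fat_forms X (residual (line_of l) \<mu>) t)"
  proof (intro fs_dim_mono)
    show "(\<lambda>F v. dot l v * F v) ` fat_forms X (residual (line_of l) \<mu>) t \<subseteq> fs.span (mon_val ` mon_exps t)"
      using mult_line_fat_forms fat_forms_finite_span[of X \<mu> t] by blast
  qed (auto intro: fs.span_base)
  ultimately show ?thesis
    unfolding dim_mult_line[OF l] by (simp add: Suc D_def)
qed simp

text \<open>Pointwise m (m + 1) = (m - 1) m + 2 m; truncated subtraction is harmless at m =
  0.\<close>

lemma residual_sum:
  assumes "finite X"
  shows "(\<Sum>p\<in>X. int (\<mu> p) * (int (\<mu> p) + 1)) =
    (\<Sum>p\<in>X. int (residual L \<mu> p) * (int (residual L \<mu> p) + 1)) + 2 * int (line_degree X L \<mu>)"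
proof -
  have "(\<Sum>p\<in>X. int (\<mu> p) * (int (\<mu> p) + 1)) =
    (\<Sum>p\<in>X. int (residual L \<mu> p) * (int (residual L \<mu> p) + 1) + (if p \<in> L then 2 * int (\<mu> p) else 0))"
  proof (rule sum.cong[OF refl])
    fix p
    show "int (\<mu> p) * (int (\<mu> p) + 1) =
      int (residual L \<mu> p) * (int (residual L \<mu> p) + 1) + (if p \<in> L then 2 * int (\<mu> p) else 0)"
      by (cases "\<mu> p") (auto simp: residual_def algebra_simps)
  qed
  also have "\<dots> = (\<Sum>p\<in>X. int (residual L \<mu> p) * (int (residual L \<mu> p) + 1)) + 2 * int (line_degree X L \<mu>)"
    using assms by (simp add: sum.distrib line_degree_def sum.If_cases sum_distrib_left)
  finally show ?thesis .
qed

text \<open>The expected dimensions of the two spaces differ by T - \<open>line_degree\<close> with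
  T = t + 1, while the dimensions differ by at most the truncated difference. The truncation error
  is the excess.\<close>

lemma h1_le_residual:
  fixes X :: "'a::alg_closed_field vec3 set"
  assumes X: "proj_point_set X" and L: "L \<in> proj_lines"
  shows "h1_twice X \<mu> (Suc t) \<le> h1_twice X (residual L \<mu>) t + 2 * int (line_degree X L \<mu> - Suc t)"
proof -
  obtain l where l: "L = line_of l" "l \<noteq> (0, 0, 0)"
    using L by (auto simp: proj_lines_def)
  have "finite X"
    using X by (simp add: proj_point_set_def)
  note sum = residual_sum[OF this, of \<mu> L]
  have "int (fs.dim (fat_forms X \<mu> (Suc t))) \<le> int (fs.dim (fat_forms X (residual L \<mu>) t)) + int (Suc t - line_degree X L \<mu>)"
    using dim_le_residual[OF X l(2), of \<mu> "Suc t"] unfolding l(1) by simp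
  moreover have "int (Suc t - line_degree X L \<mu>) = int (Suc t) - int (line_degree X L \<mu>) + int (line_degree X L \<mu> - Suc t)"
    by linarith
  ultimately show ?thesis
    unfolding h1_twice_def sum by (simp add: algebra_simps)
qed

text \<open>Here only injectivity of multiplication by the equation is used, so the difference of
  \<open>line_degree\<close> and \<open>T\<close> enters with its sign.\<close>

lemma h1_ge_residual:
  fixes X :: "'a::alg_closed_field vec3 set"
  assumes X: "finite X" and L: "L \<in> proj_lines"
  shows "h1_twice X (residual L \<mu>) (T - 1) + 2 * (int (line_degree X L \<mu>) - int T) \<le> h1_twice X \<mu> T"
proof -
  obtain l where l: "L = line_of l" "l \<noteq> (0, 0, 0)"
    using L by (auto simp: proj_lines_def)
  note sum = residual_sum[OF X, of \<mu> L]
  have "int (fs.dim (fat_forms X (residual L \<mu>) (T - 1))) \<le> int (fs.dim (fat_forms X \<mu> T))"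
    using dim_residual_le[OF l(2), of X \<mu> T] unfolding l(1) by simp
  then show ?thesis
    unfolding h1_twice_def sum by (cases T) (simp_all add: algebra_simps)
qed

section \<open>Sequences of lines\<close>

definition hits :: "(nat \<Rightarrow> 'a set) \<Rightarrow> nat \<Rightarrow> 'a \<Rightarrow> nat" where
  "hits \<Lambda> k p = card {j. j < k \<and> p \<in> \<Lambda> j}"

lemma hits_Suc: "hits \<Lambda> (Suc k) p = hits \<Lambda> k p + (if p \<in> \<Lambda> k then 1 else 0)"
proof -
  have "{j. j < Suc k \<and> p \<in> \<Lambda> j} = {j. j < k \<and> p \<in> \<Lambda> j} \<union> (if p \<in> \<Lambda> k then {k} else {})"
    by (auto simp: less_Suc_eq)
  then show ?thesis
    by (simp add: hits_def)
qed

lemma hits_0 [simp]: "hits \<Lambda> 0 p = 0"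
  by (simp add: hits_def)

text \<open>Iterated residuals are one truncated subtraction: a line through a point whose
  multiplicity is used up changes nothing there.\<close>

lemma residual_hits:
  "residual (\<Lambda> k) (\<lambda>p. \<mu> p - hits \<Lambda> k p) = (\<lambda>p. \<mu> p - hits \<Lambda> (Suc k) p)"
  by (auto simp: residual_def hits_Suc fun_eq_iff)

text \<open>The bound N <= T keeps the shifted degree positive at each removal; this budget is what
  the choice of lines has to respect.\<close>

lemma h1_le_sequence:
  fixes X :: "'a::alg_closed_field vec3 set"
  assumes X: "proj_point_set X" and "N \<le> T" and "\<And>k. k < N \<Longrightarrow> \<Lambda> k \<in> proj_lines"
  shows "h1_twice X \<mu> T \<le> h1_twice X (\<lambda>p. \<mu> p - hits \<Lambda> N p) (T - N)
    + 2 * (\<Sum>k<N. int (line_degree X (\<Lambda> k) (\<lambda>p. \<mu> p - hits \<Lambda> k p) - (T - k)))"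
  using assms(2,3)
proof (induction N)
  case (Suc N)
  then have *: "T - N = Suc (T - Suc N)"
    by simp
  have "h1_twice X (\<lambda>p. \<mu> p - hits \<Lambda> N p) (T - N) \<le> h1_twice X (\<lambda>p. \<mu> p - hits \<Lambda> (Suc N) p) (T - Suc N)
    + 2 * int (line_degree X (\<Lambda> N) (\<lambda>p. \<mu> p - hits \<Lambda> N p) - (T - N))"
    unfolding residual_hits[symmetric] * using Suc.prems by (intro h1_le_residual X) simp
  then show ?case
    using Suc by simp
qed simp

lemma h1_ge_sequence:
  fixes X :: "'a::alg_closed_field vec3 set"
  assumes X: "finite X" and "\<And>k. k < N \<Longrightarrow> \<Lambda> k \<in> proj_lines"
  shows "h1_twice X (\<lambda>p. \<mu> p - hits \<Lambda> N p) (T - N)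
    + 2 * (\<Sum>k<N. int (line_degree X (\<Lambda> k) (\<lambda>p. \<mu> p - hits \<Lambda> k p)) - int (T - k)) \<le> h1_twice X \<mu> T"
  using assms(2)
proof (induction N)
  case (Suc N)
  have "h1_twice X (\<lambda>p. \<mu> p - hits \<Lambda> (Suc N) p) (T - Suc N)
    + 2 * (int (line_degree X (\<Lambda> N) (\<lambda>p. \<mu> p - hits \<Lambda> N p)) - int (T - N)) \<le> h1_twice X (\<lambda>p. \<mu> p - hits \<Lambda> N p) (T - N)"
    unfolding residual_hits[symmetric]
    using h1_ge_residual[OF X, of "\<Lambda> N" "\<lambda>p. \<mu> p - hits \<Lambda> N p" "T - N"] Suc.prems by simp
  then show ?case
    using Suc by simp
qed simp

section \<open>Points and lines of the projective plane\<close>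

lemma cross_eq_0_imp_proportional:
  assumes "p \<noteq> (0, 0, 0)" "q \<noteq> (0, 0, 0)" "cross p q = (0, 0, 0)"
  shows "proportional p q"
proof -
  obtain p0 p1 p2 q0 q1 q2 where pq: "p = (p0, p1, p2)" "q = (q0, q1, q2)"
    by (metis prod_cases3)
  have eqs: "p1 * q2 = p2 * q1" "p2 * q0 = p0 * q2" "p0 * q1 = p1 * q0"
    using assms(3) by (auto simp: pq)
  have "\<exists>c. q = vsc c p"
  proof -
    consider "p0 \<noteq> 0" | "p1 \<noteq> 0" | "p2 \<noteq> 0"
      using assms(1) pq by auto
    then show ?thesis
    proof cases
      case 1
      then show ?thesis
        using eqs by (intro exI[of _ "q0 / p0"]) (simp add: pq field_simps)
    next
      case 2
      then show ?thesis
        using eqs by (intro exI[of _ "q1 / p1"]) (simp add: pq field_simps)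
    next
      case 3
      then show ?thesis
        using eqs by (intro exI[of _ "q2 / p2"]) (simp add: pq field_simps)
    qed
  qed
  then obtain c where "q = vsc c p"
    by blast
  moreover have "c \<noteq> 0"
    using calculation assms(2) by (cases p) auto
  ultimately show ?thesis
    unfolding proportional_iff by blast
qed

text \<open>An instance of l x (p x q) = (l . q) p - (l . p) q.\<close>

lemma cross_cross: "dot l p = 0 \<Longrightarrow> dot l q = 0 \<Longrightarrow> cross l (cross p q) = (0, 0, 0)"
proof -
  obtain a b c p0 p1 p2 q0 q1 q2 where v: "l = (a, b, c)" "p = (p0, p1, p2)" "q = (q0, q1, q2)"
    by (metis prod_cases3)
  assume "dot l p = 0" "dot l q = 0"
  then have "a * p0 + b * p1 + c * p2 = 0" "a * q0 + b * q1 + c * q2 = 0"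
    by (simp_all add: v)
  then have "b * (p0 * q1 - p1 * q0) - c * (p2 * q0 - p0 * q2) = 0"
    "c * (p1 * q2 - p2 * q1) - a * (p0 * q1 - p1 * q0) = 0"
    "a * (p2 * q0 - p0 * q2) - b * (p1 * q2 - p2 * q1) = 0"
    by algebra+
  then show "cross l (cross p q) = (0, 0, 0)"
    by (simp add: v)
qed

lemma line_of_vsc: "c \<noteq> 0 \<Longrightarrow> line_of (vsc c l) = line_of l"
proof -
  have *: "dot (vsc c l) v = c * dot l v" for v
    by (cases l; cases v) (simp add: algebra_simps)
  assume "c \<noteq> 0"
  then show ?thesis
    by (auto simp: mem_line_of *)
qed

lemma line_unique:
  assumes X: "proj_point_set X" and pq: "p \<in> X" "q \<in> X" "p \<noteq> q"
    and L: "L \<in> proj_lines" "p \<in> L" "q \<in> L"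
  shows "L = line_of (cross p q)"
proof -
  obtain l where l: "L = line_of l" "l \<noteq> (0, 0, 0)"
    using L(1) by (auto simp: proj_lines_def)
  have p0: "p \<noteq> (0, 0, 0)" and q0: "q \<noteq> (0, 0, 0)"
    using X pq unfolding proj_point_set_def by metis+
  have "\<not> proportional p q"
    using X pq unfolding proj_point_set_def by metis
  then have c0: "cross p q \<noteq> (0, 0, 0)"
    using cross_eq_0_imp_proportional[OF p0 q0] by metis
  have "cross l (cross p q) = (0, 0, 0)"
    using L(2,3) by (intro cross_cross) (simp_all add: l(1) mem_line_of)
  then have "proportional l (cross p q)"
    using l(2) c0 by (intro cross_eq_0_imp_proportional)
  then show ?thesis
    using l(1) line_of_vsc unfolding proportional_iff by metis
qed

lemma line_exists:
  assumes X: "proj_point_set X" and pq: "p \<in> X" "q \<in> X" "p \<noteq> q"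
  obtains L where "L \<in> proj_lines" "p \<in> L" "q \<in> L"
proof (rule that)
  have p0: "p \<noteq> (0, 0, 0)" and q0: "q \<noteq> (0, 0, 0)"
    using X pq unfolding proj_point_set_def by metis+
  have "\<not> proportional p q"
    using X pq unfolding proj_point_set_def by metis
  then have "cross p q \<noteq> (0, 0, 0)"
    using cross_eq_0_imp_proportional[OF p0 q0] by metis
  then show "line_of (cross p q) \<in> proj_lines"
    unfolding proj_lines_def by blast
  show "p \<in> line_of (cross p q)" "q \<in> line_of (cross p q)"
    using dot_cross_self[of p q] by (simp_all add: mem_line_of)
qed

lemma card_two_lines:
  assumes X: "proj_point_set X" and L: "L \<in> proj_lines" "L' \<in> proj_lines" "L \<noteq> L'"
  shows "card (X \<inter> L \<inter> L') \<le> 1"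
proof -
  have "p = q" if "p \<in> X \<inter> L \<inter> L'" "q \<in> X \<inter> L \<inter> L'" for p q
    using line_unique[OF X, of p q L] line_unique[OF X, of p q L'] that L by blast
  moreover have "finite (X \<inter> L \<inter> L')"
    using X by (simp add: proj_point_set_def)
  ultimately show ?thesis
    by (simp add: card_le_Suc0_iff_eq)
qed

text \<open>Each removed line contributes at least 1 to h^1, and what remains is nonnegative. The
  bound on the number of lines keeps the truncated degree m n - 1 - k exact.\<close>

lemma h1_ge_card_lines:
  fixes X :: "'a::alg_closed_field vec3 set"
  assumes X: "proj_point_set X" and \<L>: "finite \<L>" "\<L> \<subseteq> proj_lines" "\<And>L. L \<in> \<L> \<Longrightarrow> card (X \<inter> L) = n"
    and le: "card \<L> \<le> m * n"
  shows "2 * int (card \<L>) \<le> h1_twice X (\<lambda>_. m) (m * n - 1)"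
proof -
  have fin: "finite X" and X0: "(0, 0, 0) \<notin> X"
    using X by (auto simp: proj_point_set_def)
  obtain \<Lambda> where \<Lambda>: "bij_betw \<Lambda> {0..<card \<L>} \<L>"
    using ex_bij_betw_nat_finite[OF \<L>(1)] by blast
  have mem: "\<Lambda> k \<in> \<L>" if "k < card \<L>" for k
    using \<Lambda> that by (auto simp: bij_betw_def)
  have ne: "\<Lambda> k \<noteq> \<Lambda> j" if "k < card \<L>" "j < k" for k j
    using inj_on_eq_iff[OF bij_betw_imp_inj_on[OF \<Lambda>], of k j] that by simp
  txt \<open>Each of the \<open>k\<close> lines removed before meets \<open>\<Lambda> k\<close> in at most one point of \<open>X\<close>, so the degree left
    on \<open>\<Lambda> k\<close> is at least \<open>m n - k\<close>.\<close>
  have deg: "1 \<le> int (line_degree X (\<Lambda> k) (\<lambda>p. m - hits \<Lambda> k p)) - int (m * n - 1 - k)" if k: "k < card \<L>" for k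
  proof -
    have "(\<Sum>p\<in>X \<inter> \<Lambda> k. hits \<Lambda> k p) = (\<Sum>p\<in>X \<inter> \<Lambda> k. \<Sum>j<k. if p \<in> \<Lambda> j then 1 else 0)"
      by (intro sum.cong refl) (simp add: hits_def sum.If_cases Int_def)
    also have "\<dots> = (\<Sum>j<k. \<Sum>p\<in>X \<inter> \<Lambda> k. if p \<in> \<Lambda> j then 1 else 0)"
      by (rule sum.swap)
    also have "\<dots> \<le> (\<Sum>j<k. 1)"
    proof (rule sum_mono)
      fix j assume "j \<in> {..<k}"
      then have "card (X \<inter> \<Lambda> k \<inter> \<Lambda> j) \<le> 1"
        using mem ne k \<L>(2) by (intro card_two_lines[OF X]) auto
      then show "(\<Sum>p\<in>X \<inter> \<Lambda> k. if p \<in> \<Lambda> j then 1 else 0) \<le> (1::nat)"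
        using fin by (simp add: sum.If_cases)
    qed
    finally have hk: "(\<Sum>p\<in>X \<inter> \<Lambda> k. hits \<Lambda> k p) \<le> k"
      by simp
    have "m * n = (\<Sum>p\<in>X \<inter> \<Lambda> k. m)"
      using \<L>(3)[OF mem[OF k]] by simp
    also have "\<dots> \<le> (\<Sum>p\<in>X \<inter> \<Lambda> k. (m - hits \<Lambda> k p) + hits \<Lambda> k p)"
      by (rule sum_mono) simp
    also have "\<dots> = line_degree X (\<Lambda> k) (\<lambda>p. m - hits \<Lambda> k p) + (\<Sum>p\<in>X \<inter> \<Lambda> k. hits \<Lambda> k p)"
      by (simp add: line_degree_def sum.distrib)
    finally show ?thesis
      using hk k le by linarith
  qed
  have "int (card \<L>) = (\<Sum>k<card \<L>. 1)"
    by simp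
  also have "\<dots> \<le> (\<Sum>k<card \<L>. int (line_degree X (\<Lambda> k) (\<lambda>p. m - hits \<Lambda> k p)) - int (m * n - 1 - k))"
    using deg by (intro sum_mono) auto
  finally have "int (card \<L>) \<le> (\<Sum>k<card \<L>. int (line_degree X (\<Lambda> k) (\<lambda>p. m - hits \<Lambda> k p)) - int (m * n - 1 - k))" .
  moreover have "0 \<le> h1_twice X (\<lambda>p. m - hits \<Lambda> (card \<L>) p) (m * n - 1 - card \<L>)"
    by (rule h1_nonneg[OF fin X0])
  moreover have "h1_twice X (\<lambda>p. m - hits \<Lambda> (card \<L>) p) (m * n - 1 - card \<L>)
    + 2 * (\<Sum>k<card \<L>. int (line_degree X (\<Lambda> k) (\<lambda>p. m - hits \<Lambda> k p)) - int (m * n - 1 - k))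
    \<le> h1_twice X (\<lambda>_. m) (m * n - 1)"
    using mem \<L>(2) by (intro h1_ge_sequence[OF fin]) auto
  ultimately show ?thesis
    by linarith
qed

text \<open>Excess occurs in units of one, always at a line from the counted set, and never twice at
  the same line.\<close>

lemma sum_excess_le_card:
  fixes D :: "nat \<Rightarrow> nat"
  assumes "finite \<L>" and le: "\<And>k. k < N \<Longrightarrow> D k \<le> Suc (B k)"
    and mem: "\<And>k. k < N \<Longrightarrow> B k < D k \<Longrightarrow> \<Lambda> k \<in> \<L>"
    and inj: "\<And>j k. j < k \<Longrightarrow> k < N \<Longrightarrow> B j < D j \<Longrightarrow> B k < D k \<Longrightarrow> \<Lambda> j \<noteq> \<Lambda> k"
  shows "(\<Sum>k<N. int (D k - B k)) \<le> int (card \<L>)"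
proof -
  let ?E = "{k. k < N \<and> B k < D k}"
  have "(\<Sum>k<N. int (D k - B k)) \<le> (\<Sum>k<N. if B k < D k then 1 else 0)"
    by (rule sum_mono) (use le in force)
  also have "\<dots> = int (card ?E)"
    by (simp add: sum.If_cases Int_def)
  also have "card ?E \<le> card \<L>"
  proof (rule card_inj_on_le[OF _ _ assms(1)])
    show "inj_on \<Lambda> ?E"
      by (rule linorder_inj_onI) (use inj in auto)
    show "\<Lambda> ` ?E \<subseteq> \<L>"
      using mem by auto
  qed
  finally show ?thesis
    by simp
qed

section \<open>Removing lines in rounds\<close>

text \<open>Round \<open>r\<close> removes \<open>M r (s - 1), \<dots>, M r 0\<close> in this order. Indices start at 0, so \<open>M r i\<close> plays the role
  of \<open>L\<close> with index \<open>i + 1\<close> in the paper.\<close>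

locale line_rounds =
  fixes X :: "'a::alg_closed_field vec3 set" and s :: nat and Xs :: "nat \<Rightarrow> 'a vec3 set"
    and d :: "nat \<Rightarrow> nat" and M :: "nat \<Rightarrow> nat \<Rightarrow> 'a vec3 set"
  assumes X: "proj_point_set X" and s_pos: "0 < s" and X_eq: "X = (\<Union>i<s. Xs i)"
    and lines: "i < s \<Longrightarrow> M r i \<in> proj_lines"
    and own: "i < s \<Longrightarrow> Xs i \<subseteq> M r i"
    and earlier: "i < s \<Longrightarrow> j < i \<Longrightarrow> Xs j \<inter> M r i = {}"
    and later: "i < j \<Longrightarrow> j < s \<Longrightarrow> card (Xs j \<inter> M r i) \<le> 1"
    and card_Xs: "i < s \<Longrightarrow> card (Xs i) = d i"
begin

lemma finite_X: "finite X"
  using X by (simp add: proj_point_set_def)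

lemma Xs_subset: "i < s \<Longrightarrow> Xs i \<subseteq> X"
  using X_eq by blast

lemma finite_Xs: "i < s \<Longrightarrow> finite (Xs i)"
  using finite_subset[OF Xs_subset finite_X] .

text \<open>The quotient is the round and the remainder counts the index downwards;
  \<open>time\<close> inverts this numbering.\<close>

definition seq :: "nat \<Rightarrow> 'a vec3 set" where
  "seq k = M (k div s) (s - 1 - k mod s)"

abbreviation time :: "nat \<Rightarrow> nat \<Rightarrow> nat" where
  "time r i \<equiv> r * s + (s - 1 - i)"

lemma time_div: "time r i div s = r" and time_mod: "time r i mod s = s - 1 - i"
proof -
  have *: "(r * s + w) div s = r" "(r * s + w) mod s = w" if "w < s" for w
    using that by simp_all
  have "s - 1 - i < s"
    using s_pos by simp
  from *[OF this] show "time r i div s = r" "time r i mod s = s - 1 - i" .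
qed

lemma seq_time: "i < s \<Longrightarrow> seq (time r i) = M r i"
  unfolding seq_def time_div time_mod by simp

lemma seq_lines: "seq k \<in> proj_lines"
  unfolding seq_def by (rule lines) (use s_pos in simp)

lemma time_cases:
  assumes "k < m * s"
  obtains r i where "r < m" "i < s" "k = time r i"
proof (rule that)
  show "k div s < m"
    using assms by (simp add: less_mult_imp_div_less)
  show "s - 1 - k mod s < s"
    using s_pos by simp
  have "s - 1 - (s - 1 - k mod s) = k mod s"
    using mod_less_divisor[OF s_pos, of k] by linarith
  then show "k = time (k div s) (s - 1 - k mod s)"
    by simp
qed

lemma time_less:
  assumes "i < s" "i' < s" "r' < r \<or> r' = r \<and> i < i'"
  shows "time r' i' < time r i"
  using assms(3)
proof
  assume "r' < r"
  then have "(r' + 1) * s \<le> r * s"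
    by (intro mult_le_mono1) simp
  then show ?thesis
    using assms(2) by (simp add: algebra_simps)
qed (use assms in auto)

text \<open>\<open>J\<close> lists pairs (round, index) of lines through \<open>p\<close> removed
  before the given moment; distinct pairs have distinct times.\<close>

lemma hits_ge_card:
  assumes "i < s" "finite J"
    and J: "\<And>r' i'. (r', i') \<in> J \<Longrightarrow> i' < s \<and> (r' < r \<or> r' = r \<and> i < i') \<and> p \<in> M r' i'"
  shows "card J \<le> hits seq (time r i) p"
  unfolding hits_def
proof (rule card_inj_on_le)
  show "finite {j. j < time r i \<and> p \<in> seq j}"
    by simp
  show "inj_on (\<lambda>(r, i). time r i) J"
  proof (rule inj_onI, clarify)
    fix a b a' b' assume *: "(a, b) \<in> J" "(a', b') \<in> J" "time a b = time a' b'"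
    then have b: "b < s" "b' < s"
      using J by blast+
    have "a = a'"
      using *(3) time_div by metis
    moreover have "s - 1 - b = s - 1 - b'"
      using *(3) time_mod by metis
    ultimately show "a = a' \<and> b = b'"
      using b by linarith
  qed
  show "(\<lambda>(r, i). time r i) ` J \<subseteq> {j. j < time r i \<and> p \<in> seq j}"
  proof clarify
    fix a b assume "(a, b) \<in> J"
    note * = J[OF this]
    then show "time a b < time r i \<and> p \<in> seq (time a b)"
      using time_less[OF assms(1)] seq_time by metis
  qed
qed

text \<open>A point of \<open>Xs j\<close> is hit by line j in every finished round, and in the
  current one if j has already had its turn.\<close>

lemma hits_ge:
  assumes "i < s" "j < s" "p \<in> Xs j"
  shows "r + (if i < j then 1 else 0) \<le> hits seq (time r i) p"
proof -
  let ?J = "{..<r} \<times> {j} \<union> (if i < j then {(r, j)} else {})"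
  have "card ?J \<le> hits seq (time r i) p"
    using assms own[OF assms(2)] by (intro hits_ge_card) (auto split: if_splits)
  moreover have "card ?J = r + (if i < j then 1 else 0)"
    by (auto simp: card_Un_disjoint)
  ultimately show ?thesis
    by simp
qed

lemma hits_ge_extra:
  assumes "i < s" "j < s" "p \<in> Xs j" and extra: "i0 < s" "i0 \<noteq> j" "r0 < r \<or> r0 = r \<and> i < i0" "p \<in> M r0 i0"
  shows "r + (if i < j then 1 else 0) + 1 \<le> hits seq (time r i) p"
proof -
  let ?J = "{..<r} \<times> {j} \<union> (if i < j then {(r, j)} else {})"
  have "card (insert (r0, i0) ?J) \<le> hits seq (time r i) p"
    using assms own[OF assms(2)] by (intro hits_ge_card) (auto split: if_splits)
  moreover have "card ?J = r + (if i < j then 1 else 0)"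
    by (auto simp: card_Un_disjoint)
  moreover have "(r0, i0) \<notin> ?J"
    using extra(2) by auto
  moreover have "finite ?J"
    by simp
  ultimately show ?thesis
    by (metis Suc_eq_plus1 card_insert_disjoint)
qed

section \<open>Degrees left on the lines at the time of their removal\<close>

definition others :: "nat \<Rightarrow> nat \<Rightarrow> nat" where
  "others r i = card (X \<inter> M r i - Xs i)"

lemma others_subset:
  assumes "i < s"
  shows "X \<inter> M r i - Xs i \<subseteq> (\<Union>j\<in>{i<..<s}. Xs j \<inter> M r i)"
proof
  fix p assume p: "p \<in> X \<inter> M r i - Xs i"
  then obtain j where j: "j < s" "p \<in> Xs j"
    by (auto simp: X_eq)
  then have "\<not> j < i" "j \<noteq> i"
    using p earlier[OF assms, of j r] by auto
  then show "p \<in> (\<Union>j\<in>{i<..<s}. Xs j \<inter> M r i)"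
    using p j by auto
qed

lemma card_line: "i < s \<Longrightarrow> card (X \<inter> M r i) = d i + others r i"
proof -
  assume i: "i < s"
  have "X \<inter> M r i = Xs i \<union> (X \<inter> M r i - Xs i)"
    using own[OF i] Xs_subset[OF i] by auto
  then have "card (X \<inter> M r i) = card (Xs i) + card (X \<inter> M r i - Xs i)"
    using finite_X finite_Xs[OF i] by (metis Diff_disjoint card_Un_disjoint finite_Diff finite_Int)
  then show ?thesis
    by (simp add: others_def card_Xs[OF i])
qed

text \<open>Points of \<open>X\<close> on line i outside \<open>Xs i\<close> lie in later sets, each
  of which contributes at most one.\<close>

lemma others_le_card:
  assumes "i < s" "A \<subseteq> {i<..<s}" "\<And>j. j \<in> {i<..<s} - A \<Longrightarrow> Xs j \<inter> M r i = {}"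
  shows "others r i \<le> card A"
proof -
  have A: "finite A"
    using assms(2) finite_subset by blast
  have "others r i \<le> card (\<Union>j\<in>A. Xs j \<inter> M r i)"
    unfolding others_def
  proof (rule card_mono)
    show "finite (\<Union>j\<in>A. Xs j \<inter> M r i)"
      using A assms(2) finite_Xs by (intro finite_UN_I finite_Int) auto
    show "X \<inter> M r i - Xs i \<subseteq> (\<Union>j\<in>A. Xs j \<inter> M r i)"
      using others_subset[OF assms(1), of r] assms(3) by blast
  qed
  also have "\<dots> \<le> (\<Sum>j\<in>A. card (Xs j \<inter> M r i))"
    by (rule card_UN_le[OF A])
  also have "\<dots> \<le> (\<Sum>j\<in>A. 1)"
    using assms(2) later by (intro sum_mono) auto
  finally show ?thesis
    by simp
qed

lemma others_le: "i < s \<Longrightarrow> others r i \<le> s - 1 - i"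
  using others_le_card[of i "{i<..<s}" r] by simp

lemma others_less:
  assumes "i < s" "i < j" "j < s" "Xs j \<inter> M r i = {}"
  shows "others r i + 1 \<le> s - 1 - i"
proof -
  have "others r i \<le> card ({i<..<s} - {j})"
    using assms by (intro others_le_card) auto
  then show ?thesis
    using assms by simp
qed

text \<open>Own points count m - r, all others m - r - 1. One additional hit at \<open>p0\<close>
  makes the bound strict; r + 2 <= m ensures that the multiplicity allowed there is still positive
  and can drop.\<close>

lemma degree_bounds:
  assumes "i < s" "r < m"
  shows "line_degree X (M r i) (\<lambda>p. m - hits seq (time r i) p) \<le> d i * (m - r) + others r i * (m - r - 1)"
    and "\<lbrakk>p0 \<in> X \<inter> M r i; p0 \<in> Xs j; j < s; r + (if i < j then 1 else 0) + 1 \<le> hits seq (time r i) p0; r + 2 \<le> m\<rbrakk>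
      \<Longrightarrow> line_degree X (M r i) (\<lambda>p. m - hits seq (time r i) p) + 1 \<le> d i * (m - r) + others r i * (m - r - 1)"
proof -
  let ?b = "\<lambda>p. if p \<in> Xs i then m - r else m - r - 1"
  have sum: "(\<Sum>p\<in>X \<inter> M r i. ?b p) = d i * (m - r) + others r i * (m - r - 1)"
  proof -
    have "X \<inter> M r i \<inter> Xs i = Xs i"
      using own[OF assms(1)] Xs_subset[OF assms(1)] by blast
    then show ?thesis
      using finite_X card_Xs[OF assms(1)] by (simp add: sum.If_cases others_def Diff_eq)
  qed
  have le: "m - hits seq (time r i) p \<le> ?b p" if p: "p \<in> X \<inter> M r i" for p
  proof (cases "p \<in> Xs i")
    case True
    then show ?thesis
      using hits_ge[OF assms(1) assms(1) True, of r] by simp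
  next
    case False
    then obtain j where "j \<in> {i<..<s}" "p \<in> Xs j"
      using others_subset[OF assms(1), of r] p by blast
    then show ?thesis
      using hits_ge[OF assms(1), of j p r] False by simp
  qed
  show "line_degree X (M r i) (\<lambda>p. m - hits seq (time r i) p) \<le> d i * (m - r) + others r i * (m - r - 1)"
    unfolding line_degree_def sum[symmetric] using le by (intro sum_mono)
  assume p0: "p0 \<in> X \<inter> M r i" "p0 \<in> Xs j" "j < s" "r + (if i < j then 1 else 0) + 1 \<le> hits seq (time r i) p0" "r + 2 \<le> m"
  have "p0 \<notin> Xs i" if "i < j"
    using that p0(2,3) earlier[OF p0(3) that, of r] own[OF p0(3), of r] own[OF assms(1)] by blast
  moreover have "p0 \<in> Xs i" if "\<not> i < j"
    using that p0(1,2) earlier[OF assms(1), of j r] by (cases "j = i") auto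
  ultimately have strict: "m - hits seq (time r i) p0 < ?b p0"
    using p0(4,5) by (cases "i < j") auto
  have "line_degree X (M r i) (\<lambda>p. m - hits seq (time r i) p) < (\<Sum>p\<in>X \<inter> M r i. ?b p)"
    unfolding line_degree_def
  proof (rule sum_strict_mono_ex1)
    show "\<exists>p\<in>X \<inter> M r i. m - hits seq (time r i) p < ?b p"
      using p0(1) strict by (rule bexI[rotated])
  qed (use finite_X le in auto)
  then show "line_degree X (M r i) (\<lambda>p. m - hits seq (time r i) p) + 1 \<le> d i * (m - r) + others r i * (m - r - 1)"
    unfolding sum by simp
qed

text \<open>With w = s - 1 - i and e = m - r - 1, this is (d_i + w) (e + 1) <= n (e + 1) expanded,
  with \<open>others\<close> at most w. Strictness needs e >= 1 and either fewer than w other points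
  or d_i + w < n.\<close>

lemma round_bound:
  assumes "i < s" "r < m" "d i + (s - 1 - i) \<le> n"
  shows "d i * (m - r) + others r i * (m - r - 1) + (s - 1 - i) \<le> n * (m - r)"
    and "\<lbrakk>others r i + 1 \<le> s - 1 - i; r + 2 \<le> m\<rbrakk>
      \<Longrightarrow> d i * (m - r) + others r i * (m - r - 1) + (s - 1 - i) + 1 \<le> n * (m - r)"
    and "\<lbrakk>d i + others r i \<noteq> n; r + 2 \<le> m\<rbrakk>
      \<Longrightarrow> d i * (m - r) + others r i * (m - r - 1) + (s - 1 - i) + 1 \<le> n * (m - r)"
proof -
  define w where "w = s - 1 - i"
  obtain e where e: "m - r = Suc e"
    using assms(2) by (metis Suc_diff_Suc)
  have c: "others r i \<le> w"
    using others_le[OF assms(1)] by (simp add: w_def)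
  have "(d i + w) * Suc e \<le> n * Suc e"
    using assms(3) by (intro mult_le_mono1) (simp add: w_def)
  then have n: "d i * Suc e + w * e + w \<le> n * Suc e"
    by (simp add: algebra_simps)
  have ce: "others r i * e \<le> w * e"
    using c by (rule mult_le_mono1)
  show "d i * (m - r) + others r i * (m - r - 1) + (s - 1 - i) \<le> n * (m - r)"
    unfolding w_def[symmetric] e diff_Suc_1 using n ce by linarith
  have strict1: "d i * (m - r) + others r i * (m - r - 1) + (s - 1 - i) + 1 \<le> n * (m - r)"
    if "others r i + 1 \<le> s - 1 - i" "r + 2 \<le> m"
  proof -
    have "(others r i + 1) * e \<le> w * e"
      using that(1) unfolding w_def by (rule mult_le_mono1)
    then have "others r i * e + e \<le> w * e"
      by simp
    moreover have "1 \<le> e"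
      using e that(2) by linarith
    ultimately show ?thesis
      unfolding w_def[symmetric] e diff_Suc_1 using n by linarith
  qed
  then show "\<lbrakk>others r i + 1 \<le> s - 1 - i; r + 2 \<le> m\<rbrakk>
      \<Longrightarrow> d i * (m - r) + others r i * (m - r - 1) + (s - 1 - i) + 1 \<le> n * (m - r)" .
  show "d i * (m - r) + others r i * (m - r - 1) + (s - 1 - i) + 1 \<le> n * (m - r)"
    if "d i + others r i \<noteq> n" "r + 2 \<le> m"
  proof (cases "others r i = w")
    case True
    then have "(d i + w + 1) * Suc e \<le> n * Suc e"
      using assms(3) that(1) by (intro mult_le_mono1) (simp add: w_def)
    then show ?thesis
      unfolding w_def[symmetric] e diff_Suc_1 True by (simp add: algebra_simps)
  next
    case False
    then show ?thesis
      using c that(2) by (intro strict1) (simp_all add: w_def)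
  qed
qed

lemma hits_all:
  assumes "p \<in> X"
  shows "m \<le> hits seq (m * s) p"
proof -
  obtain j where "j < s" "p \<in> Xs j"
    using assms by (auto simp: X_eq)
  then show ?thesis
    \<comment> \<open>The moment \<open>time m (s - 1)\<close> is m * s, the end of m full
      rounds.\<close>
    using hits_ge[of "s - 1" j p m] s_pos by simp
qed

section \<open>Upper bounds for h^1\<close>

lemma h1_zero:
  assumes d: "\<And>i. i < s \<Longrightarrow> d i + (s - 1 - i) \<le> n" and "s \<le> n"
  shows "h1_twice X (\<lambda>_. m) (m * n) \<le> 0"
proof -
  have "line_degree X (seq k) (\<lambda>p. m - hits seq k p) - (m * n - k) = 0" if "k < m * s" for k
    using that
  proof (rule time_cases)
    fix r i assume ri: "r < m" "i < s" "k = time r i"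
    have "line_degree X (M r i) (\<lambda>p. m - hits seq (time r i) p) + (s - 1 - i) \<le> n * (m - r)"
      using degree_bounds(1)[OF ri(2,1)] round_bound(1)[OF ri(2,1) d[OF ri(2)]] by linarith
    moreover have "n * (m - r) + r * s \<le> m * n"
    proof -
      have "n * (m - r) + r * n = m * n"
        using ri(1) by (simp add: algebra_simps)
      moreover have "r * s \<le> r * n"
        using assms(2) by simp
      ultimately show ?thesis
        by linarith
    qed
    ultimately show ?thesis
      unfolding ri(3) seq_time[OF ri(2)] by linarith
  qed
  then have "(\<Sum>k<m * s. int (line_degree X (seq k) (\<lambda>p. m - hits seq k p) - (m * n - k))) = 0"
    by simp
  moreover have "h1_twice X (\<lambda>p. m - hits seq (m * s) p) (m * n - m * s) = 0"
    using hits_all by (intro h1_empty) simp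
  moreover have "m * s \<le> m * n"
    using assms(2) by simp
  ultimately show ?thesis
    using h1_le_sequence[where \<Lambda> = seq and \<mu> = "\<lambda>_. m", OF X _ seq_lines, of "m * s" "m * n"] by linarith
qed

text \<open>One degree less than in \<open>h1_zero\<close>, so an excess of one is possible. From
  the second round on, the slack r (n - s) absorbs it; in the first round distinct indices give
  distinct lines.\<close>

lemma h1_le_long:
  assumes d: "\<And>i. i < s \<Longrightarrow> d i + (s - 1 - i) \<le> n" and "s < n" "2 \<le> m"
    and same: "\<And>r i. M r i = M 0 i" and inj: "inj_on (M 0) {..<s}"
    and fin: "finite {L \<in> proj_lines. card (X \<inter> L) = n}"
  shows "h1_twice X (\<lambda>_. m) (m * n - 1) \<le> 2 * int (card {L \<in> proj_lines. card (X \<inter> L) = n})"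
proof -
  let ?D = "\<lambda>k. line_degree X (seq k) (\<lambda>p. m - hits seq k p)"
  have excess: "?D (time r i) \<le> Suc (m * n - 1 - time r i)"
    "m * n - 1 - time r i < ?D (time r i) \<Longrightarrow> r = 0 \<and> d i + others 0 i = n" if ri: "r < m" "i < s" for r i
  proof -
    have D: "?D (time r i) \<le> d i * (m - r) + others r i * (m - r - 1)"
      unfolding seq_time[OF ri(2)] by (rule degree_bounds(1)[OF ri(2,1)])
    have n: "n * (m - r) + r * n = m * n"
      using ri(1) by (simp add: algebra_simps)
    \<comment> \<open>The strict inequality s < n supplies one spare degree per finished round,
      which makes up for the missing one.\<close>
    have rs: "r * s + r \<le> r * n"
    proof -
      have "r * Suc s \<le> r * n"
        using assms(2) by (intro mult_le_mono2) simp
      then show ?thesis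
        by simp
    qed
    have pos: "1 \<le> n * (m - r)"
      using ri(1) assms(2) by simp
    note b = round_bound(1)[OF ri(2,1) d[OF ri(2)]]
    show "?D (time r i) \<le> Suc (m * n - 1 - time r i)"
      using D b n rs pos by linarith
    assume ex: "m * n - 1 - time r i < ?D (time r i)"
    have "r = 0"
      using ex D b n rs pos by linarith
    moreover have "d i + others r i = n"
    proof (rule ccontr)
      assume "d i + others r i \<noteq> n"
      from round_bound(3)[OF ri(2,1) d[OF ri(2)] this] show False
        using ex D n rs pos \<open>r = 0\<close> assms(3) by (simp add: mult.commute[of n m])
    qed
    ultimately show "r = 0 \<and> d i + others 0 i = n"
      by simp
  qed
  have "(\<Sum>k<m * s. int (?D k - (m * n - 1 - k))) \<le> int (card {L \<in> proj_lines. card (X \<inter> L) = n})"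
  proof (rule sum_excess_le_card[OF fin, where \<Lambda> = seq])
    show "?D k \<le> Suc (m * n - 1 - k)" if "k < m * s" for k
      using that by (rule time_cases) (use excess(1) in blast)
    show "seq k \<in> {L \<in> proj_lines. card (X \<inter> L) = n}" if "k < m * s" "m * n - 1 - k < ?D k" for k
      using that(1)
    proof (rule time_cases)
      fix r i assume ri: "r < m" "i < s" "k = time r i"
      then have "r = 0" "d i + others 0 i = n"
        using excess(2)[OF ri(1,2)] that(2) by blast+
      then show ?thesis
        using lines[OF ri(2), of 0] by (simp only: ri(3) seq_time[OF ri(2)] mem_Collect_eq card_line[OF ri(2)] simp_thms)
    qed
    show "seq j \<noteq> seq k" if jk: "j < k" "k < m * s" "m * n - 1 - j < ?D j" "m * n - 1 - k < ?D k" for j k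
    proof -
      obtain r i where ri: "r < m" "i < s" "k = time r i"
        using jk(2) by (rule time_cases)
      obtain r' i' where ri': "r' < m" "i' < s" "j = time r' i'"
        using less_trans[OF jk(1,2)] by (rule time_cases)
      have "r = 0" "r' = 0"
        using excess(2)[OF ri(1,2)] excess(2)[OF ri'(1,2)] jk(3,4) ri(3) ri'(3) by blast+
      then have "i \<noteq> i'"
        using jk(1) ri(3) ri'(3) by blast
      then show ?thesis
        using inj_on_eq_iff[OF inj, of i i'] ri(2) ri'(2) \<open>r = 0\<close> \<open>r' = 0\<close>
        unfolding ri(3) ri'(3) seq_time[OF ri(2)] seq_time[OF ri'(2)] by auto
    qed
  qed
  moreover have "h1_twice X (\<lambda>p. m - hits seq (m * s) p) (m * n - 1 - m * s) = 0"
    using hits_all by (intro h1_empty) simp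
  moreover have "m * s \<le> m * n - 1"
  proof -
    have "m * Suc s \<le> m * n"
      using assms(2) by (intro mult_le_mono2) simp
    then show ?thesis
      using assms(3) by simp
  qed
  ultimately show ?thesis
    using h1_le_sequence[where \<Lambda> = seq and \<mu> = "\<lambda>_. m", OF X _ seq_lines, of "m * s" "m * n - 1"] by linarith
qed

text \<open>Multiplicities are now at most 1 and zero on the last set, so s - 1 lines suffice. When
  line i is removed, at most its own i + 1 points are left, and i + 1 is also the shifted degree
  left.\<close>

lemma h1_le_last_round:
  assumes d: "\<And>i. i < s \<Longrightarrow> d i = i + 1"
    and \<nu>: "\<And>p. p \<in> X \<Longrightarrow> \<nu> p \<le> 1" "\<And>p. p \<in> Xs (s - 1) \<Longrightarrow> \<nu> p = 0"
  shows "h1_twice X \<nu> (s - 1) \<le> 0"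
proof -
  \<comment> \<open>Starts at index s - 2: the line of the last set is skipped.\<close>
  define \<Lambda> where "\<Lambda> k = M 0 (s - 2 - k)" for k
  have zero: "\<nu> p - hits \<Lambda> k p = 0" if p: "p \<in> Xs j" "j < s" "s - 1 < j + k + 1" for p j k
  proof (cases "j = s - 1")
    case True
    then show ?thesis
      using \<nu>(2) p(1) by simp
  next
    case False
    then have "s - 2 - j < k" "s - 2 - (s - 2 - j) = j"
      using p(2,3) by linarith+
    then have "s - 2 - j < k \<and> p \<in> \<Lambda> (s - 2 - j)"
      using p(1) own[OF p(2), of 0] unfolding \<Lambda>_def by auto
    then have "{s - 2 - j} \<subseteq> {i. i < k \<and> p \<in> \<Lambda> i}"
      by blast
    then have "card {s - 2 - j} \<le> hits \<Lambda> k p"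
      unfolding hits_def by (intro card_mono) auto
    moreover have "\<nu> p \<le> 1"
      using p(1,2) by (intro \<nu>(1)) (auto simp: X_eq)
    ultimately show ?thesis
      by simp
  qed
  have "line_degree X (\<Lambda> k) (\<lambda>p. \<nu> p - hits \<Lambda> k p) - (s - 1 - k) = 0" if k: "k < s - 1" for k
  proof -
    define i where "i = s - 2 - k"
    have i: "i < s" "\<Lambda> k = M 0 i" "d i = s - 1 - k"
      using k d[of i] by (auto simp: i_def \<Lambda>_def)
    have "line_degree X (\<Lambda> k) (\<lambda>p. \<nu> p - hits \<Lambda> k p) \<le> (\<Sum>p\<in>X \<inter> M 0 i. if p \<in> Xs i then 1 else 0)"
      unfolding line_degree_def i(2)
    proof (rule sum_mono)
      fix p assume p: "p \<in> X \<inter> M 0 i"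
      show "\<nu> p - hits \<Lambda> k p \<le> (if p \<in> Xs i then 1 else 0)"
      proof (cases "p \<in> Xs i")
        case True
        then show ?thesis
          using \<nu>(1)[of p] p by auto
      next
        case False
        then obtain j where j: "j \<in> {i<..<s}" "p \<in> Xs j"
          using others_subset[OF i(1), of 0] p by blast
        then have "s - 1 < j + k + 1" "j < s"
          using k by (auto simp: i_def)
        then show ?thesis
          using zero[OF j(2)] by simp
      qed
    qed
    also have "\<dots> = card (X \<inter> M 0 i \<inter> Xs i)"
      using finite_X by (simp add: sum.If_cases)
    also have "\<dots> \<le> d i"
      using card_Xs[OF i(1)] finite_Xs[OF i(1)] by (metis card_mono inf_le2)
    finally show ?thesis
      using i(3) by simp
  qed
  then have "(\<Sum>k<s - 1. int (line_degree X (\<Lambda> k) (\<lambda>p. \<nu> p - hits \<Lambda> k p) - (s - 1 - k))) = 0"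
    by simp
  moreover have "h1_twice X (\<lambda>p. \<nu> p - hits \<Lambda> (s - 1) p) (s - 1 - (s - 1)) = 0"
  proof (rule h1_empty)
    fix p assume "p \<in> X"
    then obtain j where "j < s" "p \<in> Xs j"
      by (auto simp: X_eq)
    then show "\<nu> p - hits \<Lambda> (s - 1) p = 0"
      using s_pos by (intro zero[of p j]) auto
  qed
  moreover have "\<Lambda> k \<in> proj_lines" for k
    unfolding \<Lambda>_def using s_pos by (intro lines) simp
  note h1_le_sequence[where \<Lambda> = \<Lambda> and \<mu> = \<nu> and N = "s - 1", OF X order_refl this]
  ultimately show ?thesis
    by linarith
qed

text \<open>Only m - 1 full rounds are run, followed by \<open>h1_le_last_round\<close>. The work is
  to show that a line with excess has s points and that no line shows excess twice.\<close>

lemma h1_le_short: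
  assumes "2 \<le> s" "s + 1 \<le> m" and d: "\<And>i. i < s \<Longrightarrow> d i = i + 1"
    and same: "\<And>r i. 0 < i \<Longrightarrow> M r i = M 0 i"
    and meets: "\<And>r. Xs (s - 1) \<inter> M r 0 \<noteq> {}"
    and covers: "\<And>p. p \<in> Xs (s - 1) \<Longrightarrow> \<exists>r<s. p \<in> M r 0"
    and fin: "finite {L \<in> proj_lines. card (X \<inter> L) = s}"
  shows "h1_twice X (\<lambda>_. m) (m * s - 1) \<le> 2 * int (card {L \<in> proj_lines. card (X \<inter> L) = s})"
proof -
  let ?D = "\<lambda>k. line_degree X (seq k) (\<lambda>p. m - hits seq k p)"
  let ?ex = "\<lambda>k. m * s - 1 - k < ?D k"
  have last: "s - 1 < s" "0 < s - 1"
    using assms(1) by auto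
  have dn: "d i + (s - 1 - i) \<le> s" if "i < s" for i
    using d[OF that] that by simp
  have split: "s * (m - r) + r * s = m * s" if "r < m" for r
    using that by (simp add: algebra_simps)
  have le: "?D (time r i) \<le> Suc (m * s - 1 - time r i)" if ri: "r < m - 1" "i < s" for r i
  proof -
    have "r < m"
      using ri(1) by simp
    then show ?thesis
      using degree_bounds(1)[OF ri(2), of r m] round_bound(1)[OF ri(2) _ dn[OF ri(2)], of r m] split[of r]
      unfolding seq_time[OF ri(2)] by linarith
  qed
  have bound: "\<not> ?ex (time r i)" if ri: "r < m - 1" "i < s" and "?D (time r i) + (s - 1 - i) + 1 \<le> s * (m - r)" for r i
    using that(3) split[of r] ri(1) by linarith
  have ex_card: "d i + others r i = s" if ri: "r < m - 1" "i < s" and ex: "?ex (time r i)" for r i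
  proof (rule ccontr)
    assume "d i + others r i \<noteq> s"
    then have "?D (time r i) + (s - 1 - i) + 1 \<le> s * (m - r)"
      using degree_bounds(1)[OF ri(2), of r m] round_bound(3)[OF ri(2) _ dn[OF ri(2)], of r m] ri(1)
      unfolding seq_time[OF ri(2)] by linarith
    then show False
      using bound[OF ri] ex by blast
  qed
  \<comment> \<open>With n = s the estimates are tight, so one point of the line hit more often than
    guaranteed rules out excess.\<close>
  have ex_hits: "\<not> r + (if i < j then 1 else 0) + 1 \<le> hits seq (time r i) p"
    if ri: "r < m - 1" "i < s" and ex: "?ex (time r i)" and p: "p \<in> X \<inter> M r i" "p \<in> Xs j" "j < s" for r i j p
  proof
    assume h: "r + (if i < j then 1 else 0) + 1 \<le> hits seq (time r i) p"
    have rm: "r < m" "r + 2 \<le> m"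
      using ri(1) by auto
    have "?D (time r i) + (s - 1 - i) + 1 \<le> s * (m - r)"
      using degree_bounds(2)[OF ri(2) rm(1) p h rm(2)] round_bound(1)[OF ri(2) rm(1) dn[OF ri(2)]]
      unfolding seq_time[OF ri(2)] by linarith
    then show False
      using bound[OF ri] ex by blast
  qed
  \<comment> \<open>For i > 0 the line is the same in all rounds. From the second round on, a point
    of the last set on it has an additional hit: from \<open>M 0 0\<close> if i = s - 1, else from
    line i itself in round 0. In the latter case such a point exists because excess forces the line
    to meet every later set.\<close>
  have ex_first: "r = 0" if ri: "r < m - 1" "i < s" and ex: "?ex (time r i)" and "0 < i" for r i
  proof (rule ccontr)
    assume "r \<noteq> 0"
    show False
    proof (cases "i = s - 1")
      case True
      obtain p where p: "p \<in> Xs (s - 1)" "p \<in> M 0 0"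
        using meets[of 0] by blast
      have "p \<in> X \<inter> M r i"
        using p(1) own[OF last(1), of r] Xs_subset[OF last(1)] True by auto
      then show False
        using ex_hits[OF ri ex _ p(1) last(1)]
          hits_ge_extra[OF ri(2) last(1) p(1), of 0 0 r] s_pos last(2) p(2) \<open>r \<noteq> 0\<close> by simp
    next
      case False
      then have i: "i < s - 1"
        using ri(2) by simp
      have "Xs (s - 1) \<inter> M r i \<noteq> {}"
        using others_less[OF ri(2) i last(1), of r] ex_card[OF ri ex] d[OF ri(2)] by force
      then obtain p where p: "p \<in> Xs (s - 1)" "p \<in> M r i"
        by blast
      have "p \<in> X \<inter> M r i"
        using p Xs_subset[OF last(1)] by auto
      moreover have "p \<in> M 0 i"
        using p(2) same[OF \<open>0 < i\<close>, of r] by simp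
      ultimately show False
        using ex_hits[OF ri ex _ p(1) last(1)]
          hits_ge_extra[OF ri(2) last(1) p(1) ri(2), of 0 r] i \<open>r \<noteq> 0\<close> by simp
    qed
  qed
  \<comment> \<open>If the line with index 0 repeats an earlier one, its point of the last set was
    already hit by that line besides its own.\<close>
  have ex_new: "M r' 0 \<noteq> M r 0" if r: "r < m - 1" and ex: "?ex (time r 0)" and "r' < r" for r r'
  proof
    assume eq: "M r' 0 = M r 0"
    obtain p where p: "p \<in> Xs (s - 1)" "p \<in> M r 0"
      using meets[of r] by blast
    have "p \<in> X \<inter> M r 0"
      using p Xs_subset[OF last(1)] by auto
    moreover have "p \<in> M r' 0"
      using p eq by simp
    ultimately show False
      using ex_hits[OF r s_pos ex _ p(1) last(1)]
        hits_ge_extra[OF s_pos last(1) p(1) s_pos, of r' r] last(2) \<open>r' < r\<close> by simp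
  qed
  have M_ne: "M r i \<noteq> M r' i'" if "i < i'" "i' < s" for r r' i i'
  proof
    assume eq: "M r i = M r' i'"
    have "i < s"
      using that by simp
    then have "Xs i \<noteq> {}"
      using card_Xs[of i] d[of i] by auto
    then show False
      using own[OF \<open>i < s\<close>, of r] earlier[OF that(2,1), of r'] eq by blast
  qed
  have "(\<Sum>k<(m - 1) * s. int (?D k - (m * s - 1 - k))) \<le> int (card {L \<in> proj_lines. card (X \<inter> L) = s})"
  proof (rule sum_excess_le_card[OF fin, where \<Lambda> = seq])
    show "?D k \<le> Suc (m * s - 1 - k)" if "k < (m - 1) * s" for k
      using that by (rule time_cases) (use le in blast)
    show "seq k \<in> {L \<in> proj_lines. card (X \<inter> L) = s}" if "k < (m - 1) * s" "?ex k" for k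
      using that(1)
    proof (rule time_cases)
      fix r i assume ri: "r < m - 1" "i < s" "k = time r i"
      then have "d i + others r i = s"
        using ex_card[OF ri(1,2)] that(2) by blast
      then show ?thesis
        using lines[OF ri(2), of r] by (simp only: ri(3) seq_time[OF ri(2)] mem_Collect_eq card_line[OF ri(2)] simp_thms)
    qed
    show "seq j \<noteq> seq k" if jk: "j < k" "k < (m - 1) * s" "?ex j" "?ex k" for j k
    proof -
      obtain r i where ri: "r < m - 1" "i < s" "k = time r i"
        using jk(2) by (rule time_cases)
      obtain r' i' where ri': "r' < m - 1" "i' < s" "j = time r' i'"
        using less_trans[OF jk(1,2)] by (rule time_cases)
      have "M r' i' \<noteq> M r i"
      proof (cases "i' = i")
        case True
        have "r' < r"
        proof (rule ccontr)
          assume "\<not> r' < r"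
          then have "r * s \<le> r' * s"
            by simp
          then show False
            using jk(1) unfolding ri(3) ri'(3) True by linarith
        qed
        show ?thesis
        proof (cases "i = 0")
          case i0: True
          show ?thesis
            using ex_new[OF ri(1) _ \<open>r' < r\<close>] jk(4) unfolding ri(3) True i0 by blast
        next
          case False
          then show ?thesis
            using ex_first[OF ri(1,2)] jk(4) \<open>r' < r\<close> unfolding ri(3) by blast
        qed
      next
        case False
        then show ?thesis
          using M_ne[of i i' r r'] M_ne[of i' i r' r] ri(2) ri'(2) by (metis linorder_neqE_nat)
      qed
      then show ?thesis
        unfolding ri(3) ri'(3) seq_time[OF ri(2)] seq_time[OF ri'(2)] .
    qed
  qed
  moreover have "h1_twice X (\<lambda>p. m - hits seq ((m - 1) * s) p) (s - 1) \<le> 0"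
  proof (rule h1_le_last_round[OF d])
    show "m - hits seq ((m - 1) * s) p \<le> 1" if "p \<in> X" for p
      using hits_all[OF that, of "m - 1"] by linarith
    show "m - hits seq ((m - 1) * s) p = 0" if p: "p \<in> Xs (s - 1)" for p
    proof -
      obtain r where r: "r < s" "p \<in> M r 0"
        using covers[OF p] by blast
      \<comment> \<open>Here m >= s + 1 is used: the line with index 0 through \<open>p\<close>
        occurs within the first s rounds, hence before round m - 1. The m - 1 own hits and this one
        use up the multiplicity m.\<close>
      have "m - 1 + 0 + 1 \<le> hits seq (time (m - 1) (s - 1)) p"
        using hits_ge_extra[OF last(1) last(1) p s_pos, of r "m - 1"] last(2) r assms(2) by simp
      then show ?thesis
        by simp
    qed
  qed
  moreover have "h1_twice X (\<lambda>_. m) (m * s - 1) \<le> h1_twice X (\<lambda>p. m - hits seq ((m - 1) * s) p) (s - 1)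
    + 2 * (\<Sum>k<(m - 1) * s. int (?D k - (m * s - 1 - k)))"
  proof -
    have T: "m * s - 1 - (m - 1) * s = s - 1" "(m - 1) * s \<le> m * s - 1"
      using assms(1,2) by (auto simp: diff_mult_distrib)
    show ?thesis
      using h1_le_sequence[where \<Lambda> = seq and \<mu> = "\<lambda>_. m", OF X T(2) seq_lines] unfolding T(1) .
  qed
  ultimately show ?thesis
    by linarith
qed

end

section \<open>The count of lines\<close>

text \<open>The Hilbert function is the degree of the scheme minus h^1; the number of monomials
  cancels against the expected dimension.\<close>

lemma twice_hilb_fat:
  fixes X :: "'a::alg_closed_field vec3 set"
  shows "2 * hilb_fat m X (int t) = (\<Sum>p\<in>X. int m * (int m + 1)) - h1_twice X (\<lambda>_. m) (Suc t)"
proof -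
  have "2 * int (card (mon_exps t)) = (int t + 1) * (int t + 2)"
    using card_mon_exps[of t] by (metis (mono_tags, lifting) of_nat_1 of_nat_add of_nat_mult of_nat_numeral)
  moreover have "int (Suc t) * (int (Suc t) + 1) = (int t + 1) * (int t + 2)"
    by (simp add: algebra_simps)
  moreover have "hilb_fat m X (int t) = int (card (mon_exps t)) - int (fs.dim (fat_forms X (\<lambda>_. m) (Suc t)))"
    by (simp add: hilb_fat_def kdim_forms kdim_fat_ideal)
  ultimately show ?thesis
    unfolding h1_twice_def by linarith
qed

text \<open>Bounds the points of \<open>X\<close> on a line that meets every \<open>Xs i\<close> at
  most once by the number of sets met; it limits the candidates for lines with d_s points.\<close>

lemma card_le_meeting:
  fixes s :: nat
  assumes "\<And>i. i < s \<Longrightarrow> card (Xs i \<inter> L) \<le> 1" "A \<subseteq> {..<s}" "\<And>i. i < s \<Longrightarrow> i \<notin> A \<Longrightarrow> Xs i \<inter> L = {}"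
    and fin: "\<And>i. i < s \<Longrightarrow> finite (Xs i)"
  shows "card ((\<Union>i<s. Xs i) \<inter> L) \<le> card A"
proof -
  have A: "finite A"
    by (rule finite_subset[OF assms(2)]) simp
  have "(\<Union>i<s. Xs i) \<inter> L \<subseteq> (\<Union>i\<in>A. Xs i \<inter> L)"
  proof
    fix p assume "p \<in> (\<Union>i<s. Xs i) \<inter> L"
    then obtain i where "i < s" "p \<in> Xs i" "p \<in> L"
      by auto
    then show "p \<in> (\<Union>i\<in>A. Xs i \<inter> L)"
      using assms(3)[of i] by auto
  qed
  moreover have "finite (\<Union>i\<in>A. Xs i \<inter> L)"
  proof (rule finite_UN_I[OF A])
    fix i assume "i \<in> A"
    then have "finite (Xs i)"
      using assms(2) by (intro fin) auto
    then show "finite (Xs i \<inter> L)"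
      by simp
  qed
  ultimately have "card ((\<Union>i<s. Xs i) \<inter> L) \<le> card (\<Union>i\<in>A. Xs i \<inter> L)"
    by (rule card_mono[rotated])
  also have "\<dots> \<le> (\<Sum>i\<in>A. card (Xs i \<inter> L))"
    by (rule card_UN_le[OF A])
  also have "\<dots> \<le> (\<Sum>i\<in>A. 1)"
  proof (rule sum_mono)
    fix i assume "i \<in> A"
    then show "card (Xs i \<inter> L) \<le> 1"
      using assms(2) by (intro assms(1)) auto
  qed
  finally show ?thesis
    by simp
qed

lemma strictly_sorted_nth_diff:
  assumes "sorted_wrt (<) (d :: nat list)" "i \<le> j" "j < length d"
  shows "d ! i + (j - i) \<le> d ! j"
  using assms(2,3)
proof (induction j rule: dec_induct)
  case (step j)
  have "d ! j < d ! Suc j"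
    using assms(1) step.prems by (intro sorted_wrt_nth_less) auto
  then show ?case
    using step by simp
qed simp

theorem theorem1p2:
  fixes X :: "'a::alg_closed_field vec3 set" and d :: "nat list"
  assumes "k_configuration X d" and "d \<noteq> [1]"
  shows "\<forall>m::nat. m \<ge> (if last d > length d then 2 else length d + 1) \<longrightarrow>
           delta_hilb_fat m X (int (m * last d) - 1) =
           int (card {L \<in> proj_lines. card (X \<inter> L) = last d})"
proof (intro allI impI)
  fix m :: nat assume m: "(if last d > length d then 2 else length d + 1) \<le> m"
  define s where "s = length d"
  define n where "n = last d"
  define \<L> where "\<L> = {L \<in> proj_lines. card (X \<inter> L) = n}"
  have X: "proj_point_set X" and ne: "d \<noteq> []" and d0: "1 \<le> d ! 0" and sorted: "sorted_wrt (<) d"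
    and ex: "\<exists>Xs :: nat \<Rightarrow> 'a vec3 set. \<exists>L :: nat \<Rightarrow> 'a vec3 set. X = (\<Union>i<length d. Xs i) \<and>
        (\<forall>i<length d. L i \<in> proj_lines) \<and>
        (\<forall>i<length d. \<forall>j<length d. i \<noteq> j \<longrightarrow> L i \<noteq> L j) \<and>
        (\<forall>i<length d. card (Xs i) = d ! i \<and> Xs i \<subseteq> L i) \<and>
        (\<forall>i<length d. \<forall>j<i. Xs j \<inter> L i = {})"
    using assms(1) unfolding k_configuration_def by - (elim conjE, assumption)+
  from ex obtain Xs L :: "nat \<Rightarrow> 'a vec3 set" where conf: "X = (\<Union>i<length d. Xs i) \<and>
        (\<forall>i<length d. L i \<in> proj_lines) \<and>
        (\<forall>i<length d. \<forall>j<length d. i \<noteq> j \<longrightarrow> L i \<noteq> L j) \<and>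
        (\<forall>i<length d. card (Xs i) = d ! i \<and> Xs i \<subseteq> L i) \<and>
        (\<forall>i<length d. \<forall>j<i. Xs j \<inter> L i = {})"
    by (elim exE) (rule that)
  have X_eq: "X = (\<Union>i<s. Xs i)"
    using conf unfolding s_def by (elim conjE)
  have L: "L i \<in> proj_lines" if "i < s" for i
    using conf that unfolding s_def by simp
  have L_ne: "L i \<noteq> L j" if "i < s" "j < s" "i \<noteq> j" for i j
    using conf that unfolding s_def by simp
  have card_Xs: "card (Xs i) = d ! i" and own: "Xs i \<subseteq> L i" if "i < s" for i
    using conf that unfolding s_def by simp_all
  have earlier: "Xs j \<inter> L i = {}" if "i < s" "j < i" for i j
    using conf that unfolding s_def by simp
  have fin: "finite X" and X0: "(0, 0, 0) \<notin> X"
    using X by (auto simp: proj_point_set_def)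
  have s: "0 < s" "s - 1 < s"
    using ne by (simp_all add: s_def)
  have n: "n = d ! (s - 1)"
    using ne by (simp add: n_def s_def last_conv_nth)
  have d_le: "d ! i + (s - 1 - i) \<le> n" if "i < s" for i
    using strictly_sorted_nth_diff[OF sorted, of i "s - 1"] that n by (simp add: s_def)
  have d_ge: "i + 1 \<le> d ! i" if "i < s" for i
    using strictly_sorted_nth_diff[OF sorted, of 0 i] that d0 by (simp add: s_def)
  have sn: "s \<le> n"
    using d_ge[OF s(2)] n by simp
  have m2: "2 \<le> m"
    using m s(1) unfolding s_def[symmetric] by (simp split: if_splits)
  have Xs_sub: "Xs i \<subseteq> X" if "i < s" for i
    using that X_eq by blast
  have fin_Xs: "finite (Xs i)" if "i < s" for i
    using finite_subset[OF Xs_sub[OF that] fin] .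
  have meet_le: "card (Xs j \<inter> L') \<le> 1" if "j < s" "L' \<in> proj_lines" "L' \<noteq> L j" for j L'
  proof -
    have "card (Xs j \<inter> L') \<le> card (X \<inter> L' \<inter> L j)"
      using own[OF that(1)] Xs_sub[OF that(1)] fin by (intro card_mono) auto
    also have "\<dots> \<le> 1"
      using that L by (intro card_two_lines[OF X]) auto
    finally show ?thesis .
  qed
  \<comment> \<open>The same lines in every round. This instance gives h^1 = 0 in degree m n - 1 in
    both cases, and the second upper bound if s < n.\<close>
  interpret lr: line_rounds X s Xs "\<lambda>i. d ! i" "\<lambda>r. L"
  proof unfold_locales
    show "card (Xs j \<inter> L i) \<le> 1" if "i < j" "j < s" for i j
      using that L_ne[of i j] by (intro meet_le L) auto
  qed (use X s X_eq L own earlier card_Xs in auto)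
  have mn: "2 \<le> m * n"
    using mult_le_mono[OF m2, of 1 n] sn s(1) by simp
  \<comment> \<open>Finiteness and the bound m * n are what \<open>h1_ge_card_lines\<close>
    requires; both come from listing all candidates for lines with n points.\<close>
  have key: "finite \<L> \<and> card \<L> \<le> m * n \<and> h1_twice X (\<lambda>_. m) (m * n - 1) \<le> 2 * int (card \<L>)"
  proof (cases "s < n")
    case True
    \<comment> \<open>A line other than the \<open>L i\<close> meets each \<open>Xs i\<close> at
      most once, so it has at most s < n points.\<close>
    have sub: "\<L> \<subseteq> L ` {..<s}"
    proof
      fix L' assume L': "L' \<in> \<L>"
      show "L' \<in> L ` {..<s}"
      proof (rule ccontr)
        assume "L' \<notin> L ` {..<s}"
        then have "card (X \<inter> L') \<le> card {..<s}"
          unfolding X_eq using L' by (intro card_le_meeting meet_le fin_Xs) (auto simp: \<L>_def)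
        then show False
          using L' True by (simp add: \<L>_def)
      qed
    qed
    then have "finite \<L>"
      using finite_subset by blast
    moreover have "card \<L> \<le> s"
      using card_mono[OF _ sub] card_image_le[of "{..<s}" L] by simp
    moreover have "s \<le> m * n"
      using sn mult_le_mono1[of 1 m n] m2 by linarith
    moreover have "h1_twice X (\<lambda>_. m) (m * n - 1) \<le> 2 * int (card \<L>)"
      unfolding \<L>_def
    proof (rule lr.h1_le_long[OF d_le True m2])
      show "inj_on L {..<s}"
        using L_ne by (auto simp: inj_on_def)
      show "finite {L \<in> proj_lines. card (X \<inter> L) = n}"
        using \<open>finite \<L>\<close> by (simp add: \<L>_def)
    qed auto
    ultimately show ?thesis
      by linarith
  next
    case False
    then have n_s: "n = s"
      using sn by simp
    \<comment> \<open>For n = s the lower bound from d_0 >= 1 and the upper bound from the last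
      entry coincide.\<close>
    have d_eq: "d ! i = i + 1" if "i < s" for i
      using d_le[OF that] d_ge[OF that] that n_s by linarith
    \<comment> \<open>The excluded type (1) is exactly the case s = 1 here.\<close>
    have s2: "2 \<le> s"
    proof (rule ccontr)
      assume "\<not> 2 \<le> s"
      then have "length d = 1"
        using s(1) unfolding s_def by linarith
      then have "d = [d ! 0]"
        by (cases d) auto
      then show False
        using d_eq[OF s(1)] assms(2) by simp
    qed
    have ms: "s + 1 \<le> m"
      using m False by (simp add: s_def n_def)
    obtain P where P: "Xs 0 = {P}"
      using card_Xs[OF s(1)] d_eq[OF s(1)] by (auto simp: card_1_singleton_iff)
    have PX: "P \<in> X"
      using P Xs_sub[OF s(1)] by simp
    have P_notin: "P \<notin> L i" if "0 < i" "i < s" for i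
      using earlier[OF that(2,1)] P by blast
    have top: "finite (Xs (s - 1))" "card (Xs (s - 1)) = s"
      using fin_Xs[OF s(2)] card_Xs[OF s(2)] n n_s by simp_all
    obtain A where A: "bij_betw A {0..<s} (Xs (s - 1))"
      using ex_bij_betw_nat_finite[OF top(1)] top(2) by auto
    \<comment> \<open>Reducing r modulo s cycles through the s points of the last set, so every
      round has a line through P and one of them, and the first s rounds reach all.\<close>
    have A_mem: "A (r mod s) \<in> Xs (s - 1)" for r
      using A s(1) by (auto simp: bij_betw_def)
    have P_ne: "P \<noteq> A (r mod s)" for r
      using A_mem[of r] own[OF s(2)] P_notin[of "s - 1"] s2 by auto
    have "\<exists>N. N \<in> proj_lines \<and> P \<in> N \<and> A (r mod s) \<in> N" for r
      using line_exists[OF X PX _ P_ne[of r]] A_mem[of r] Xs_sub[OF s(2)] by blast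
    then obtain N where N: "\<And>r. N r \<in> proj_lines" "\<And>r. P \<in> N r" "\<And>r. A (r mod s) \<in> N r"
      by metis
    define M where "M r i = (if i = 0 then N r else L i)" for r i :: nat
    have covers: "\<exists>r<s. p \<in> N r" if "p \<in> Xs (s - 1)" for p
    proof -
      obtain r where "r < s" "p = A r"
        using \<open>p \<in> Xs (s - 1)\<close> bij_betw_imp_surj_on[OF A] by (metis atLeastLessThan_iff imageE)
      then show ?thesis
        using N(3)[of r] by auto
    qed
    interpret sr: line_rounds X s Xs "\<lambda>i. d ! i" M
    proof unfold_locales
      show "card (Xs j \<inter> M r i) \<le> 1" if "i < j" "j < s" for r i j
      proof (cases "i = 0")
        case True
        then have "N r \<noteq> L j"
          using N(2)[of r] P_notin[of j] that by blast
        then show ?thesis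
          using meet_le[OF that(2) N(1)] True by (simp add: M_def)
      next
        case False
        then show ?thesis
          using that L_ne[of i j] meet_le[OF that(2) L[of i]] by (simp add: M_def)
      qed
    qed (use X s X_eq L own earlier card_Xs N P in \<open>auto simp: M_def\<close>)
    \<comment> \<open>A line with s points different from \<open>L 1\<close>, ...,
      \<open>L (s - 1)\<close> meets each of the s sets exactly once. So it contains P and a point
      of the last set and is one of the \<open>N r\<close>.\<close>
    have sub: "\<L> \<subseteq> L ` {1..<s} \<union> N ` {..<s}"
    proof
      fix L' assume L': "L' \<in> \<L>"
      show "L' \<in> L ` {1..<s} \<union> N ` {..<s}"
      proof (cases "L' \<in> L ` {1..<s}")
        case False
        have le: "card (Xs i \<inter> L') \<le> 1" if "i < s" for i
        proof (cases "i = 0")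
          case True
          then show ?thesis
            by (simp add: P card_insert_if Int_insert_left)
        next
          case i: False
          then have "L' \<noteq> L i"
            using False that by auto
          then show ?thesis
            using L' that by (intro meet_le) (auto simp: \<L>_def)
        qed
        have meets: "Xs j \<inter> L' \<noteq> {}" if "j < s" for j
        proof
          assume "Xs j \<inter> L' = {}"
          then have "card (X \<inter> L') \<le> card ({..<s} - {j})"
            unfolding X_eq using le fin_Xs by (intro card_le_meeting) auto
          then show False
            using L' n_s that by (simp add: \<L>_def)
        qed
        have "P \<in> L'"
          using meets[OF s(1)] P by auto
        obtain p where p: "p \<in> Xs (s - 1)" "p \<in> L'"
          using meets[OF s(2)] by blast
        obtain r where r: "r < s" "p \<in> N r"
          using covers[OF p(1)] by blast
        have pX: "p \<in> X" "P \<noteq> p"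
          using p(1) Xs_sub[OF s(2)] own[OF s(2)] P_notin[of "s - 1"] s2 by auto
        have "L' = line_of (cross P p)"
          using L' \<open>P \<in> L'\<close> p(2) by (intro line_unique[OF X PX pX]) (auto simp: \<L>_def)
        moreover have "N r = line_of (cross P p)"
          by (rule line_unique[OF X PX pX N(1) N(2) r(2)])
        ultimately show ?thesis
          using r(1) by auto
      qed simp
    qed
    then have finL: "finite \<L>"
      by (rule finite_subset) simp
    have "card \<L> \<le> card (L ` {1..<s}) + card (N ` {..<s})"
      using card_mono[OF _ sub] card_Un_le[of "L ` {1..<s}" "N ` {..<s}"] by simp
    also have "\<dots> \<le> (s - 1) + s"
      using card_image_le[of "{1..<s}" L] card_image_le[of "{..<s}" N] by simp
    also have "\<dots> \<le> 2 * s"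
      by simp
    also have "\<dots> \<le> m * n"
      using m2 n_s by simp
    finally have "card \<L> \<le> m * n" .
    moreover have "h1_twice X (\<lambda>_. m) (m * n - 1) \<le> 2 * int (card \<L>)"
      unfolding \<L>_def n_s
    proof (rule sr.h1_le_short[OF s2 ms d_eq])
      show "Xs (s - 1) \<inter> M r 0 \<noteq> {}" for r
        using A_mem[of r] N(3)[of r] by (auto simp: M_def)
      show "\<exists>r<s. p \<in> M r 0" if "p \<in> Xs (s - 1)" for p
        using covers[OF that] by (simp add: M_def)
      show "finite {L \<in> proj_lines. card (X \<inter> L) = s}"
        using finL by (simp add: \<L>_def n_s)
    qed (simp_all add: M_def)
    ultimately show ?thesis
      using finL by blast
  qed
  have "2 * int (card \<L>) \<le> h1_twice X (\<lambda>_. m) (m * n - 1)"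
    using key by (intro h1_ge_card_lines[OF X]) (auto simp: \<L>_def)
  then have h1: "h1_twice X (\<lambda>_. m) (m * n - 1) = 2 * int (card \<L>)"
    using key by linarith
  have h0: "h1_twice X (\<lambda>_. m) (m * n) = 0"
    using lr.h1_zero[OF d_le sn, of m] h1_nonneg[OF fin X0, of "\<lambda>_. m" "m * n"] by linarith
  have t: "int (m * n) - 1 = int (m * n - 1)" "int (m * n - 1) - 1 = int (m * n - 2)"
    "Suc (m * n - 1) = m * n" "Suc (m * n - 2) = m * n - 1"
    using mn by linarith+
  \<comment> \<open>The degree term S cancels in the difference, and h^1 in degree m n - 1 is 0;
    what is left is h^1 in degree m n - 2.\<close>
  have *: "2 * (a - b) = y" if "2 * a = S - x" "2 * b = S - y" "x = 0" for a b S x y :: int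
    using that by simp
  have "2 * delta_hilb_fat m X (int (m * n) - 1) = 2 * int (card \<L>)"
    unfolding delta_hilb_fat_def t h1[symmetric]
    by (rule *[OF twice_hilb_fat[of m X "m * n - 1"] twice_hilb_fat[of m X "m * n - 2"], unfolded t]) (rule h0)
  then show "delta_hilb_fat m X (int (m * last d) - 1) = int (card {L \<in> proj_lines. card (X \<inter> L) = last d})"
    unfolding \<L>_def n_def by linarith
qed

end
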